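(* Let $f\colon\mathbb{N}\to\mathbb{N}\cup\{\infty\}$ be such that $f(1)=1$ and $f(n)\geq\binom{3n+1}{3}$ for every $n\geq 2$. Then there exists a hereditary class of graphs $\mathcal{G}$ such that $\chi_{\mathcal{G}}(n)=f(n)$ for every $n\in\mathbb{N}$.
   Context: Graphs are finite and simple, and $\mathbb{N}=\{1,2,3,\dots\}$. For a graph $G$, $\chi(G)$ denotes its chromatic number and $\omega(G)$ its clique number. A class of graphs is hereditary if it is closed under taking induced subgraphs. For a class of graphs $\mathcal{C}$, its $\chi$-bounding function $\chi_{\mathcal{C}}\colon\mathbb{N}\to\mathbb{N}\cup\{\infty\}$ is defined by $\chi_{\mathcal{C}}(n)=\sup\{\chi(G)\colon G\in\mathcal{C}\text{ and }\omega(G)=n\}$. *)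

theory Defs
  imports
    "Graph_Theory.Pair_Digraph"
    "Graph_Theory.Digraph_Component"
    "Graph_Theory.Digraph_Isomorphism"
    "HOL-Library.Extended_Nat"
begin

text \<open>
  A finite simple graph is a \<^locale>\<open>pair_graph\<close>: a finite, symmetric, loop-free digraph without
  parallel arcs, an edge \<open>uv\<close> being represented by the two arcs \<open>(u, v)\<close> and \<open>(v, u)\<close>.
  The null graph is allowed; it has clique number and chromatic number \<open>0\<close>.
\<close>

definition is_clique :: "'a pair_pre_digraph \<Rightarrow> 'a set \<Rightarrow> bool" where
  "is_clique G K \<longleftrightarrow>
     K \<subseteq> pverts G \<and> (\<forall>u\<in>K. \<forall>v\<in>K. u \<noteq> v \<longrightarrow> (u, v) \<in> parcs G)"

definition clique_number :: "'a pair_pre_digraph \<Rightarrow> nat" where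
  "clique_number G = Max (card ` {K. is_clique G K})"

definition proper_coloring :: "'a pair_pre_digraph \<Rightarrow> nat \<Rightarrow> ('a \<Rightarrow> nat) \<Rightarrow> bool" where
  "proper_coloring G k c \<longleftrightarrow>
     (\<forall>v\<in>pverts G. c v < k) \<and> (\<forall>(u, v)\<in>parcs G. c u \<noteq> c v)"

definition chromatic_number :: "'a pair_pre_digraph \<Rightarrow> nat" where
  "chromatic_number G = (LEAST k. \<exists>c. proper_coloring G k c)"

text \<open>
  Every finite graph has an isomorphic copy with vertices in \<^typ>\<open>nat\<close>, so a class of graphs
  is represented by an isomorphism-closed set of graphs on natural numbers.
\<close>

definition graph_class :: "nat pair_pre_digraph set \<Rightarrow> bool" where
  "graph_class C \<longleftrightarrow>
     (\<forall>G\<in>C. pair_graph G) \<and>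
     (\<forall>G\<in>C. \<forall>H. digraph_iso (with_proj G) (with_proj H) \<longrightarrow> H \<in> C)"

definition hereditary :: "nat pair_pre_digraph set \<Rightarrow> bool" where
  "hereditary C \<longleftrightarrow>
     (\<forall>G\<in>C. \<forall>H. induced_subgraph (with_proj H) (with_proj G) \<longrightarrow> H \<in> C)"

text \<open>
  The value is meant for \<open>n \<ge> 1\<close>. The supremum of the empty set is \<open>0\<close> in \<^typ>\<open>enat\<close>.
\<close>

definition chi_bounding :: "nat pair_pre_digraph set \<Rightarrow> nat \<Rightarrow> enat" where
  "chi_bounding C n = (SUP G \<in> {G \<in> C. clique_number G = n}. enat (chromatic_number G))"

end

theory Submission
  imports Defs Complex_Main "HOL-Computational_Algebra.Primes" "HOL-Number_Theory.Cong"
begin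

text \<open>
  The class consists of all graphs in which every induced subgraph of clique number \<open>m \<ge> 1\<close> has
  chromatic number at most \<open>f m\<close>. It is hereditary, closed under isomorphism, and its bounding
  function is at most \<open>f\<close>. For equality it remains to find, for \<open>n \<ge> 2\<close> and every
  \<open>k \<ge> (3n+1 choose 3)\<close>, a graph of clique number \<open>n\<close> and chromatic number \<open>k\<close> whose
  induced subgraphs of clique number \<open>m < n\<close> have chromatic number at most
  \<open>(3m+1 choose 3)\<close> (lemma \<open>exists_graph\<close>).

  Such a graph is made from an acyclic digraph of large chromatic number in which any two
  vertices are joined by at most one directed path (\<open>zykov\<close>). All that is used of it is the
  reachability relation together with the path length, which is additive along reachable triples
  (locale \<open>distance_order\<close>). Pick a prime \<open>p\<close> with \<open>2n < p < 3n\<close>, and join two comparable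
  vertices when their path length is, modulo \<open>p\<close>, at circular distance between \<open>1\<close> and
  \<open>n - 1\<close> from \<open>0\<close>. A clique is a chain whose positions on the circle \<open>Z/p\<close> are distinct and
  pairwise at circular distance less than \<open>n\<close>, so it has at most \<open>n\<close> elements. Path length 1 is
  an edge, so the chromatic number is large, and passing to a suitable subset of the vertices makes
  it equal to \<open>k\<close>.

  Consider the larger graph that joins comparable vertices whenever the path length is
  not divisible by \<open>p\<close>. Averaging over the \<open>p\<close> arcs of \<open>n\<close> consecutive residues, a clique
  of size \<open>w\<close> of this larger graph contains a clique of size at least \<open>wn/p > w/3\<close> of the smaller
  one (\<open>large_short_clique\<close>). Hence a vertex set whose clique number in the smaller graph is
  \<open>m < n\<close> has clique number \<open>w < p\<close>, \<open>w \<le> 3m - 1\<close> in the larger graph. Finally, a set of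
  clique number \<open>w < p\<close> in the larger graph can be coloured with \<open>(w+2 choose 3)\<close> colours
  (\<open>colorable_full\<close>): for a vertex \<open>v\<close> let \<open>a\<close> be the largest size of a clique with top \<open>v\<close>,
  record each such clique of size \<open>a\<close> by its set of residues relative to \<open>v\<close>, and let \<open>I\<close> be the
  intersection of these sets. Along an edge \<open>u v\<close> of residue \<open>r\<close> with the same \<open>a\<close>, every
  maximum clique at \<open>u\<close> must contain a vertex of residue \<open>r\<close>, and exchanging it for \<open>v\<close> gives a
  maximum clique at \<open>v\<close>. So \<open>r \<in> I(u)\<close> and \<open>I(v) \<subseteq> I(u) - r\<close>. If also \<open>c = |I|\<close> is the same, then
  \<open>I(v)\<close> is a rotation of \<open>I(u)\<close>, and as \<open>p\<close> is prime and \<open>c < p\<close> the place of \<open>0\<close> in a canonical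
  rotation of \<open>I\<close> separates \<open>u\<close> from \<open>v\<close>. The number of triples \<open>(a, c, i)\<close> with
  \<open>i < c \<le> a \<le> w\<close> is \<open>(w+2 choose 3)\<close>.

  The existence of the prime \<open>p\<close> is a theorem of El Bachraoui. For large \<open>n\<close> it is proved by
  Chebyshev's method: without such a prime, \<open>(3n choose n)\<close>, which is about \<open>(27/4)^n\<close>, would be
  at most \<open>(3n)^(sqrt (3n))\<close> times the product of the primes up to \<open>3n/2\<close>. This product is at
  most a constant times \<open>(10/3)^(3n/2)\<close>, and \<open>(10/3)^(3/2) < 27/4\<close>. For small \<open>n\<close> an explicit
  chain of primes is used.
\<close>

section \<open>A bound for the product of the primes up to a number\<close>

text \<open>Legendre's formula; the terms with \<open>p ^ i > n\<close> vanish, so any upper limit \<open>N \<ge> n\<close> will do.\<close>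

lemma multiplicity_fact:
  fixes p :: nat
  assumes "prime p" "n \<le> N"
  shows "multiplicity p (fact n :: nat) = (\<Sum>i=1..N. n div p ^ i)"
  using assms(2)
proof (induction n)
  case 0
  then show ?case by simp
next
  case (Suc n)
  have p1: "p > 1" using assms(1) prime_gt_1_nat by blast
  have "multiplicity p (Suc n) \<le> N"
  proof -
    have "p ^ multiplicity p (Suc n) \<le> Suc n"
      by (meson dvd_imp_le multiplicity_dvd zero_less_Suc)
    moreover have "multiplicity p (Suc n) < p ^ multiplicity p (Suc n)"
      using p1 by (simp add: power_gt_expt)
    ultimately show ?thesis using Suc.prems by linarith
  qed
  then have "{i\<in>{1..N}. p ^ i dvd Suc n} = {1..multiplicity p (Suc n)}"
    using p1 by (auto simp: power_dvd_iff_le_multiplicity)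
  then have "multiplicity p (Suc n) = card {i\<in>{1..N}. p ^ i dvd Suc n}"
    by simp
  also have "\<dots> = (\<Sum>i=1..N. if p ^ i dvd Suc n then 1 else 0)"
    by (simp add: sum.If_cases Int_def conj_commute)
  finally have m: "multiplicity p (Suc n) = (\<Sum>i=1..N. if p ^ i dvd Suc n then 1 else 0)" .
  have "multiplicity p (fact (Suc n) :: nat) = multiplicity p (Suc n) + multiplicity p (fact n :: nat)"
    unfolding fact_Suc of_nat_id
    using assms(1) by (intro prime_elem_multiplicity_mult_distrib) auto
  also have "\<dots> = (\<Sum>i=1..N. (if p ^ i dvd Suc n then 1 else 0) + n div p ^ i)"
    using Suc m by (simp add: sum.distrib)
  also have "\<dots> = (\<Sum>i=1..N. Suc n div p ^ i)"
    by (intro sum.cong refl) (auto simp: div_Suc dvd_eq_mod_eq_0)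
  finally show ?case .
qed

text \<open>The product of all primes up to \<open>x\<close>.\<close>

definition primorial :: "nat \<Rightarrow> nat" where
  "primorial x = \<Prod>{p. prime p \<and> p \<le> x}"

lemma finite_primes_le: "finite {p::nat. prime p \<and> P p \<and> p \<le> x}" "finite {p::nat. prime p \<and> p \<le> x}"
  by (rule finite_subset[of _ "{..x}"]; force)+

lemma primorial_pos: "primorial x > 0"
  unfolding primorial_def by (rule prod_pos) (auto simp: prime_gt_0_nat)

lemma primorial_mono: "x \<le> y \<Longrightarrow> primorial x \<le> primorial y"
  unfolding primorial_def
  by (rule dvd_imp_le[OF prod_dvd_prod_subset])
    (auto simp: finite_primes_le prime_gt_0_nat intro!: prod_pos)

text \<open>
  The next two lemmas compare the exponents of a prime in \<open>(6m)! m!\<close> and in \<open>(3m)! ((2m)!)^2\<close>.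
  They show that the quotient is an integer divisible by all primes in \<open>(2m, 6m]\<close>. The quotient
  is at most \<open>108^m\<close>, which bounds the primorial.
\<close>

lemma div_six_three_two:
  fixes m N :: nat
  assumes "N > 0"
  shows "(3*m) div N + 2 * ((2*m) div N) \<le> (6*m) div N + m div N"
proof -
  define t s where "t = m div N" and "s = m mod N"
  have m: "m = t * N + s" and s: "s < N" using assms by (auto simp: t_def s_def)
  have e: "(k * m) div N = k * t + (k * s) div N" for k
    using assms by (simp add: m algebra_simps)
  have "(3*s) div N + 2 * ((2*s) div N) \<le> (6*s) div N"
  proof (cases "2 * s < N")
    case True
    then show ?thesis by (auto intro: div_le_mono)
  next
    case False
    have "(2*s) div N = 1" using False s by (intro div_nat_eqI) auto
    moreover have "(3*s) div N = 1 \<and> (6*s) div N \<ge> 3 \<or> (3*s) div N = 2 \<and> (6*s) div N \<ge> 4"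
    proof (cases "3 * s < 2 * N")
      case True
      have "(3*s) div N = 1" using False True by (intro div_nat_eqI) auto
      moreover have "3 \<le> (6*s) div N" using False assms by (auto simp: less_eq_div_iff_mult_less_eq)
      ultimately show ?thesis by simp
    next
      case 2: False
      have "(3*s) div N = 2" using 2 s by (intro div_nat_eqI) auto
      moreover have "4 \<le> (6*s) div N" using 2 assms by (auto simp: less_eq_div_iff_mult_less_eq)
      ultimately show ?thesis by simp
    qed
    ultimately show ?thesis by auto
  qed
  then show ?thesis using e[of 3] e[of 2] e[of 6] e[of 1] s by simp
qed

lemma div_six_three_two_strict:
  fixes m q :: nat
  assumes "2*m < q" "q \<le> 6*m"
  shows "Suc ((3*m) div q + 2 * ((2*m) div q)) \<le> (6*m) div q + m div q"
proof (cases "3 * m < q")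
  case True
  then have "1 \<le> (6*m) div q" using assms by (auto simp: less_eq_div_iff_mult_less_eq)
  then show ?thesis using True assms by simp
next
  case False
  have "(3*m) div q = 1" using False assms by (intro div_nat_eqI) auto
  moreover have "2 \<le> (6*m) div q" using False assms by (auto simp: less_eq_div_iff_mult_less_eq)
  ultimately show ?thesis using assms by simp
qed

lemma prod_primes_dvd:
  "\<Prod>{p. prime p \<and> 2*m < p \<and> p \<le> 6*m} * (fact (3*m) * (fact (2*m))\<^sup>2) dvd (fact (6*m) * fact m :: nat)"
    (is "\<Prod>?S * ?A dvd ?B")
proof (rule multiplicity_le_imp_dvd)
  have fin: "finite ?S" by (rule finite_primes_le)
  show "\<Prod>?S * ?A \<noteq> 0"
    using fin by (auto simp: prime_gt_0_nat)
  fix q :: nat assume q: "prime q"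
  define N where "N = 6*m"
  have q0: "q > 0" using q prime_gt_0_nat by blast
  note pe = prime_elem_multiplicity_mult_distrib[OF prime_imp_prime_elem[OF q]]
    prime_elem_multiplicity_power_distrib[OF prime_imp_prime_elem[OF q]]
  have S0: "\<Prod>?S \<noteq> 0" using fin by (auto simp: prime_gt_0_nat)
  define b where "b \<longleftrightarrow> q \<in> ?S"
  have "multiplicity q (\<Prod>?S) = (if b then 1 else 0)"
    unfolding b_def
    using multiplicity_prod_prime_powers[OF fin, of q "\<lambda>_. 1"] q by simp
  also have "\<dots> = (\<Sum>i=1..N. if i = 1 \<and> b then 1 else 0)"
  proof (cases b)
    case True
    then have "1 \<in> {1..N}" using q0 by (simp add: b_def N_def)
    then show ?thesis using True by simp
  qed simp
  finally have mS: "multiplicity q (\<Prod>?S) = (\<Sum>i=1..N. if i = 1 \<and> b then 1 else 0)" .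
  have mf: "multiplicity q (fact k :: nat) = (\<Sum>i=1..N. k div q ^ i)" if "k \<le> N" for k
    using multiplicity_fact[OF q that] .
  have "multiplicity q (\<Prod>?S * ?A) =
      (\<Sum>i=1..N. (if i = 1 \<and> b then 1 else 0) + ((3*m) div q^i + 2 * ((2*m) div q^i)))"
    using S0 mS by (simp add: pe mf N_def sum.distrib sum_distrib_left)
  also have "\<dots> \<le> (\<Sum>i=1..N. (6*m) div q^i + m div q^i)"
  proof (rule sum_mono)
    fix i assume "i \<in> {1..N}"
    show "(if i = 1 \<and> b then 1 else 0) + ((3*m) div q^i + 2 * ((2*m) div q^i))
        \<le> (6*m) div q^i + m div q^i"
    proof (cases "i = 1 \<and> b")
      case True
      then show ?thesis using div_six_three_two_strict[of m q] by (simp add: b_def)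
    next
      case False
      have "q ^ i > 0" using q0 by simp
      then show ?thesis using div_six_three_two[of "q^i" m] False by (simp only: if_False add_0_left)
    qed
  qed
  also have "\<dots> = multiplicity q ?B"
    by (simp add: pe mf N_def sum.distrib)
  finally show "multiplicity q (\<Prod>?S * ?A) \<le> multiplicity q ?B" .
qed

lemma fact_add2: "fact (k + 2) = (fact k * ((k+1) * (k+2)) :: nat)"
  and fact_add3: "fact (k + 3) = (fact k * ((k+1) * (k+2) * (k+3)) :: nat)"
  and fact_add6: "fact (k + 6) = (fact k * ((k+1) * (k+2) * (k+3) * (k+4) * (k+5) * (k+6)) :: nat)"
  by (simp_all add: numeral_eq_Suc mult_ac del: mult_Suc mult_Suc_right)

lemma fact_quotient_le:
  "fact (6*m) * fact m \<le> (108::nat) ^ m * (fact (3*m) * (fact (2*m))\<^sup>2)"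
proof (induction m)
  case 0
  then show ?case by simp
next
  case (Suc m)
  define a where "a = (6*m+1)*(6*m+2)*(6*m+3)*(6*m+4)*(6*m+5)*(6*m+6)*(m+1)"
  define b where "b = (3*m+1)*(3*m+2)*(3*m+3)*((2*m+1)*(2*m+2))\<^sup>2"
  have "6*(6*m+1)*(6*m+5) \<le> 108 * ((2*m+1)*(m+1))"
    by (simp add: algebra_simps)
  then have "(6*(6*m+1)*(6*m+5)) * ((3*m+1)*(3*m+2)*(3*m+3)*4*(2*m+1)*(m+1))
     \<le> (108 * ((2*m+1)*(m+1))) * ((3*m+1)*(3*m+2)*(3*m+3)*4*(2*m+1)*(m+1))"
    by (rule mult_right_mono) simp
  moreover have "(6*(6*m+1)*(6*m+5)) * ((3*m+1)*(3*m+2)*(3*m+3)*4*(2*m+1)*(m+1)) = a"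
    unfolding a_def by (simp add: algebra_simps)
  moreover have "(108 * ((2*m+1)*(m+1))) * ((3*m+1)*(3*m+2)*(3*m+3)*4*(2*m+1)*(m+1)) = 108 * b"
    unfolding b_def by (simp add: algebra_simps power2_eq_square)
  ultimately have ab: "a \<le> 108 * b" by (simp only:)
  have e6: "6 * Suc m = 6 * m + 6" and e3: "3 * Suc m = 3 * m + 3" and e2: "2 * Suc m = 2 * m + 2"
    by simp_all
  have e1: "fact (Suc m) = fact m * (m + 1)" by simp
  have f6: "fact (6 * Suc m) * fact (Suc m) = (fact (6*m) * fact m) * a"
    unfolding e1 e6 fact_add6 a_def by (simp only: mult_ac)
  have f3: "fact (3 * Suc m) * (fact (2 * Suc m))\<^sup>2 = (fact (3*m) * (fact (2*m))\<^sup>2) * b"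
    unfolding e3 e2 fact_add3 fact_add2 b_def power_mult_distrib by (simp only: mult_ac)
  have "(fact (6*m) * fact m) * a \<le> (108 ^ m * (fact (3*m) * (fact (2*m))\<^sup>2)) * (108 * b)"
    using Suc.IH ab by (rule mult_mono) auto
  then show ?case unfolding f6 f3 by (simp add: algebra_simps)
qed

lemma primorial_step: "primorial (6*m) \<le> 108 ^ m * primorial (2*m)"
proof -
  let ?S = "{p. prime p \<and> 2*m < p \<and> p \<le> 6*m}"
  let ?A = "fact (3*m) * (fact (2*m))\<^sup>2 :: nat"
  have "\<Prod>?S * ?A \<le> fact (6*m) * fact m"
    by (rule dvd_imp_le[OF prod_primes_dvd]) simp
  also have "\<dots> \<le> 108 ^ m * ?A" by (rule fact_quotient_le)
  finally have S: "\<Prod>?S \<le> 108 ^ m" by simp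
  have "{p. prime p \<and> p \<le> 6*m} = {p. prime p \<and> p \<le> 2*m} \<union> ?S" by auto
  then have "primorial (6*m) = primorial (2*m) * \<Prod>?S"
    unfolding primorial_def by (simp add: prod.union_disjoint finite_primes_le disjoint_iff)
  then show ?thesis using S by (simp add: mult.commute)
qed

text \<open>
  Any base above \<open>108^(1/4)\<close>, which is about \<open>3.22\<close>, would do with a suitable constant. The
  constant absorbs the small values of \<open>x\<close>, where rounding \<open>x\<close> up to a multiple of 6 costs too
  much.
\<close>

lemma primorial_le: "real (primorial x) \<le> real (primorial 400) * (10/3) ^ x"
proof (induction x rule: less_induct)
  case (less x)
  show ?case
  proof (cases "x < 400")
    case True
    then have "real (primorial x) * 1 \<le> real (primorial 400) * (10/3) ^ x"
      by (intro mult_mono) (auto simp: primorial_mono)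
    then show ?thesis by simp
  next
    case False
    define m where "m = x div 6"
    have m: "m \<ge> 66" "6 * m \<le> x" "x \<le> 6 * (m + 1)" using False by (auto simp: m_def)
    \<comment> \<open>\<open>1200 = 108 * (10/3)^2\<close> is the cost of rounding \<open>x\<close> up to \<open>6 * (m + 1)\<close>.\<close>
    have "(1200::real) \<le> 2 ^ 11" by simp
    also have "(2::real) ^ 11 \<le> ((10000/8748) ^ 6) ^ 11"
      by (rule power_mono) (simp_all add: power_divide)
    also have "\<dots> = (10000/8748) ^ 66" by (simp flip: power_mult)
    also have "\<dots> \<le> (10000/8748) ^ m" using m by (intro power_increasing) auto
    finally have "1200 * 108 ^ m \<le> (10000/8748) ^ m * (108::real) ^ m"
      by (rule mult_right_mono) simp
    also have "\<dots> = ((10/3)^4) ^ m"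
      unfolding power_mult_distrib[symmetric] by (simp add: power_divide)
    finally have "1200 * 108 ^ m \<le> ((10/3::real)^4) ^ m" .
    moreover have "108 ^ (m+1) * (10/3::real) ^ 2 = 1200 * 108 ^ m"
      by (simp add: power2_eq_square)
    ultimately have *: "108 ^ (m+1) * (10/3::real) ^ 2 \<le> (10/3) ^ (4*m)"
      unfolding power_mult by (simp only:)
    have "primorial x \<le> primorial (6 * (m+1))" using m by (intro primorial_mono) auto
    also have "\<dots> \<le> 108 ^ (m+1) * primorial (2 * (m+1))" by (rule primorial_step)
    finally have "real (primorial x) \<le> 108 ^ (m+1) * real (primorial (2*(m+1)))"
      by (metis of_nat_le_iff of_nat_mult of_nat_numeral of_nat_power)
    also have "\<dots> \<le> 108 ^ (m+1) * (real (primorial 400) * (10/3) ^ (2*(m+1)))"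
      by (intro mult_left_mono less.IH) (use m in auto)
    also have "\<dots> = real (primorial 400) * (10/3) ^ (2*m) * (108 ^ (m+1) * (10/3) ^ 2)"
      by (simp add: power_add power2_eq_square algebra_simps)
    also have "\<dots> \<le> real (primorial 400) * (10/3) ^ (2*m) * (10/3) ^ (4*m)"
      using * by (intro mult_left_mono) auto
    also have "\<dots> = real (primorial 400) * (10/3) ^ (6*m)"
      by (simp flip: power_add)
    also have "\<dots> \<le> real (primorial 400) * (10/3) ^ x"
      using m by (intro mult_left_mono power_increasing) auto
    finally show ?thesis .
  qed
qed

section \<open>A prime between 2n and 3n\<close>

lemma multiplicity_binomial:
  assumes "prime q" "3 * n \<le> N"
  shows "multiplicity q ((3*n) choose n) =
    (\<Sum>i=1..N. (3*n) div q^i - n div q^i - (2*n) div q^i)"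
proof -
  note pe = prime_elem_multiplicity_mult_distrib[OF prime_imp_prime_elem[OF assms(1)]]
  have mf: "multiplicity q (fact k :: nat) = (\<Sum>i=1..N. k div q ^ i)" if "k \<le> N" for k
    using multiplicity_fact[OF assms(1) that] .
  have "fact (3*n) = (fact n * fact (2*n) * ((3*n) choose n) :: nat)"
    using binomial_fact_lemma[of n "3*n"] by simp
  then have "multiplicity q (fact (3*n) :: nat) =
      multiplicity q (fact n * fact (2*n) * ((3*n) choose n))" by simp
  then have 1: "(\<Sum>i=1..N. (3*n) div q^i) =
      (\<Sum>i=1..N. n div q^i) + (\<Sum>i=1..N. (2*n) div q^i) + multiplicity q ((3*n) choose n)"
    using assms(2) by (simp add: pe mf)
  have "(3*n) div q^i = n div q^i + (2*n) div q^i + ((3*n) div q^i - n div q^i - (2*n) div q^i)" for i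
    using div_add1_eq[of n "2*n" "q^i"] by simp
  then have "(\<Sum>i=1..N. (3*n) div q^i) = (\<Sum>i=1..N. n div q^i + (2*n) div q^i
     + ((3*n) div q^i - n div q^i - (2*n) div q^i))" by (intro sum.cong refl)
  then show ?thesis using 1 by (simp add: sum.distrib)
qed

lemma div_add_le:
  fixes a b N :: nat
  assumes "N > 0"
  shows "(a + b) div N \<le> a div N + b div N + 1"
proof -
  have "a mod N < N" "b mod N < N" using assms by simp_all
  then have "a mod N + b mod N < 2 * N" by linarith
  from less_mult_imp_div_less[OF this] have "(a mod N + b mod N) div N \<le> 1" by simp
  then show ?thesis by (simp add: div_add1_eq[of a b N])
qed

lemma prime_power_binomial_le:
  assumes "prime q" "n > 0"
  shows "q ^ multiplicity q ((3*n) choose n) \<le> 3 * n"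
proof -
  define S where "S = {i\<in>{1..3*n}. q ^ i \<le> 3 * n}"
  have q1: "q > 1" using assms(1) prime_gt_1_nat by blast
  have "multiplicity q ((3*n) choose n) =
      (\<Sum>i=1..3*n. (3*n) div q^i - n div q^i - (2*n) div q^i)"
    by (rule multiplicity_binomial) (use assms in auto)
  also have "\<dots> \<le> (\<Sum>i=1..3*n. if q ^ i \<le> 3 * n then 1 else 0)"
  proof (rule sum_mono)
    fix i
    show "(3*n) div q^i - n div q^i - (2*n) div q^i \<le> (if q ^ i \<le> 3 * n then 1 else 0)"
    proof (cases "q ^ i \<le> 3 * n")
      case True
      have "(3*n) div q^i \<le> n div q^i + (2*n) div q^i + 1"
        using div_add_le[of "q^i" n "2*n"] q1 by simp
      then show ?thesis using True by simp
    next
      case False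
      then show ?thesis by simp
    qed
  qed
  also have "\<dots> = card S"
    by (simp add: S_def sum.If_cases Int_def)
  finally have e: "multiplicity q ((3*n) choose n) \<le> card S" .
  have finS: "finite S" by (simp add: S_def)
  show ?thesis
  proof (cases "S = {}")
    case True
    then show ?thesis using e assms(2) by simp
  next
    case False
    have "card S \<le> card {1..Max S}"
      using finS by (intro card_mono) (auto simp: S_def)
    then have "q ^ multiplicity q ((3*n) choose n) \<le> q ^ Max S"
      using e q1 by (intro power_increasing) auto
    also have "\<dots> \<le> 3 * n"
      using Max_in[OF finS False] by (simp add: S_def)
    finally show ?thesis .
  qed
qed

text \<open>
  If there is no prime between \<open>2n\<close> and \<open>3n\<close>, then all primes dividing \<open>(3n choose n)\<close> are at
  most \<open>3n/2\<close>, because those in \<open>(3n/2, 2n]\<close> divide each of \<open>(3n)!\<close> and \<open>(2n)!\<close> exactly once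
  and do not divide \<open>n!\<close>. Primes above \<open>sqrt (3n)\<close> occur with exponent at most 1.
\<close>

lemma binomial_le_primorial:
  assumes n: "n \<ge> 2" and s: "3 * n < (s + 1)\<^sup>2"
    and no_prime: "\<And>q. prime q \<Longrightarrow> 2 * n < q \<Longrightarrow> \<not> q < 3 * n"
  shows "(3*n) choose n \<le> (3*n) ^ s * primorial (3 * n div 2)"
proof -
  define C where "C = (3*n) choose n"
  define A where "A = {q\<in>prime_factors C. q \<le> s}"
  define B where "B = {q\<in>prime_factors C. q > s}"
  have C0: "C > 0" by (simp add: C_def)
  have le: "q ^ multiplicity q C \<le> 3 * n" if "q \<in> prime_factors C" for q
    using prime_power_binomial_le[of q n] that n by (auto simp: C_def)
  have B1: "q ^ multiplicity q C = q \<and> q \<le> 3 * n div 2" if "q \<in> B" for q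
  proof -
    have q: "prime q" "q dvd C" "q > s" using that by (auto simp: B_def)
    have m1: "multiplicity q C \<ge> 1"
      using q C0 by (intro multiplicity_geI) auto
    have "3 * n < q\<^sup>2"
      using s q(3) power_mono[of "s + 1" q 2] by linarith
    have "\<not> multiplicity q C \<ge> 2"
    proof
      assume "multiplicity q C \<ge> 2"
      then have "q\<^sup>2 \<le> q ^ multiplicity q C"
        using prime_ge_1_nat[OF q(1)] by (intro power_increasing) auto
      then show False using le[of q] that \<open>3 * n < q\<^sup>2\<close> by (auto simp: B_def)
    qed
    then have m: "multiplicity q C = 1" using m1 by simp
    have "q \<le> 3 * n div 2"
    proof (rule ccontr)
      assume "\<not> q \<le> 3 * n div 2"
      then have q2: "2 * q > 3 * n" by auto
      have q3: "q \<le> 3 * n" using le[of q] that m by (auto simp: B_def)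
      have "q \<noteq> 3 * n"
      proof
        assume "q = 3 * n"
        then have "3 dvd q" by simp
        then have "q = 3" using q(1) primes_dvd_imp_eq[of 3 q] by simp
        then show False using \<open>q = 3 * n\<close> n by simp
      qed
      then have q4: "q \<le> 2 * n" using no_prime[OF q(1)] q3 by linarith
      have "(3*n) div q^i - n div q^i - (2*n) div q^i = 0" if "i \<in> {1..3*n}" for i
      proof (cases "i = 1")
        case True
        have "(3*n) div q = 1" "(2*n) div q = 1"
          using q2 q4 n by (auto intro!: div_nat_eqI)
        then show ?thesis using True by simp
      next
        case False
        then have "q\<^sup>2 \<le> q ^ i"
          using that prime_ge_1_nat[OF q(1)] by (intro power_increasing) auto
        then show ?thesis using \<open>3 * n < q\<^sup>2\<close> by simp
      qed
      then have "multiplicity q C = 0"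
        unfolding C_def using multiplicity_binomial[OF q(1), of n "3*n"] by simp
      then show False using m by simp
    qed
    then show ?thesis using m by simp
  qed
  have "C = (\<Prod>q\<in>prime_factors C. q ^ multiplicity q C)"
    using C0 by (simp add: prime_factorization_nat)
  also have "prime_factors C = A \<union> B" by (auto simp: A_def B_def)
  also have "(\<Prod>q\<in>A \<union> B. q ^ multiplicity q C) =
      (\<Prod>q\<in>A. q ^ multiplicity q C) * (\<Prod>q\<in>B. q ^ multiplicity q C)"
    by (intro prod.union_disjoint) (auto simp: A_def B_def)
  also have "(\<Prod>q\<in>B. q ^ multiplicity q C) = \<Prod>B"
    using B1 by (intro prod.cong) auto
  also have "(\<Prod>q\<in>A. q ^ multiplicity q C) * \<Prod>B \<le> (3*n) ^ s * primorial (3 * n div 2)"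
  proof (rule mult_mono)
    have "A \<subseteq> {1..s}" by (auto simp: A_def Suc_le_eq dest!: in_prime_factors_imp_prime prime_gt_0_nat)
    then have "card A \<le> s" using card_mono[of "{1..s}" A] by simp
    have "(\<Prod>q\<in>A. q ^ multiplicity q C) \<le> (\<Prod>q\<in>A. 3 * n)"
      by (rule prod_mono) (auto simp: A_def le)
    also have "\<dots> = (3*n) ^ card A" by simp
    also have "\<dots> \<le> (3*n) ^ s" using \<open>card A \<le> s\<close> n by (intro power_increasing) auto
    finally show "(\<Prod>q\<in>A. q ^ multiplicity q C) \<le> (3*n) ^ s" .
    have "\<Prod>B dvd primorial (3 * n div 2)"
      unfolding primorial_def using B1
      by (intro prod_dvd_prod_subset finite_primes_le) (auto simp: B_def)
    then show "\<Prod>B \<le> primorial (3 * n div 2)"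
      by (rule dvd_imp_le) (rule primorial_pos)
  qed auto
  finally show ?thesis by (simp add: C_def)
qed

lemma binomial_ge:
  assumes "n \<ge> 1"
  shows "27 ^ n \<le> 4 ^ n * (3 * n) * ((3*n) choose n)"
  using assms
proof (induction n rule: dec_induct)
  case base
  then show ?case by simp
next
  case (step n)
  define a where "a = 3 * ((3*n+1) * (3*n+2))"
  define b where "b = (2*n+1) * (2*n+2)"
  have "((3 * Suc n) choose (Suc n)) * (fact (Suc n) * fact (2 * Suc n)) = (fact (3 * Suc n) :: nat)"
    using binomial_fact_lemma[of "Suc n" "3 * Suc n"] by (simp add: mult_ac)
  also have "\<dots> = fact (3*n) * ((3*n+1) * (3*n+2) * (3*n+3))"
    by (simp add: eval_nat_numeral algebra_simps)
  also have "fact (3*n) = fact n * fact (2*n) * ((3*n) choose n)"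
    using binomial_fact_lemma[of n "3*n"] by simp
  also have "fact (Suc n) * fact (2 * Suc n) = (fact n * fact (2*n)) * ((n+1) * b)"
    by (simp add: b_def eval_nat_numeral algebra_simps)
  finally have "(fact n * fact (2*n)) * (((3 * Suc n) choose (Suc n)) * b * (n + 1)) =
     (fact n * fact (2*n)) * (((3*n) choose n) * a * (n + 1))"
    by (simp add: a_def algebra_simps)
  then have r: "((3 * Suc n) choose (Suc n)) * b = ((3*n) choose n) * a"
    by (metis mult_cancel_right add_is_0 one_neq_zero mult_cancel_left fact_nonzero mult_eq_0_iff)
  have ab: "27 * n * b \<le> 4 * (n + 1) * a"
    by (simp add: a_def b_def algebra_simps)
  have "n * b * 27 ^ Suc n = 27 * n * b * 27 ^ n" by simp
  also have "\<dots> \<le> (4 * (n+1) * a) * (4 ^ n * (3 * n) * ((3*n) choose n))"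
    using ab step.IH by (rule mult_mono) auto
  also have "\<dots> = n * (4 ^ Suc n * (3 * Suc n)) * (((3*n) choose n) * a)"
    by (simp add: algebra_simps)
  also have "\<dots> = n * b * (4 ^ Suc n * (3 * Suc n) * ((3 * Suc n) choose (Suc n)))"
    unfolding r[symmetric] by (simp add: algebra_simps)
  finally show ?case using step.hyps by (simp add: b_def)
qed

lemma ln_2_le: "ln 2 \<le> (3/4 :: real)"
proof -
  have "2 \<le> exp (3/4 :: real)"
    using exp_lower_Taylor_quadratic[of "3/4"] by (simp add: power2_eq_square)
  then have "ln 2 \<le> ln (exp (3/4 :: real))" by (subst ln_le_cancel_iff) auto
  then show ?thesis by simp
qed

text \<open>The final numerical comparison, to be used with \<open>z = sqrt (3n)\<close> and \<open>n \<ge> 200000\<close>.\<close>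

lemma log_estimate:
  fixes z :: real
  assumes "z \<ge> 774"
  shows "(z + 1) * (2 * ln z) + 2620 < z\<^sup>2 / 36"
proof -
  \<comment> \<open>The tangent of \<open>ln\<close> at 1024 is used.\<close>
  have "ln z = ln (z / 1024) + ln (2 ^ 10)"
    using ln_mult[of "z / 1024" "2 ^ 10"] assms by simp
  also have "\<dots> \<le> (z / 1024 - 1) + 10 * (3/4)"
    using ln_le_minus_one[of "z / 1024"] ln_2_le assms
    by (intro add_mono) (auto simp: ln_realpow simp del: power_numeral)
  finally have "ln z \<le> z / 1024 + 13/2" by simp
  then have "(z + 1) * (2 * ln z) \<le> (z + 1) * (2 * (z / 1024 + 13/2))"
    using assms by (intro mult_left_mono) auto
  also have "\<dots> = z\<^sup>2 / 512 + 6657/512 * z + 13"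
    by (simp add: field_simps power2_eq_square)
  finally have "(z + 1) * (2 * ln z) \<le> z\<^sup>2 / 512 + 6657/512 * z + 13" .
  moreover have "z\<^sup>2 / 512 + 6657/512 * z + 13 + 2620 < z\<^sup>2 / 36"
  proof -
    have "774 * z \<le> z\<^sup>2" using assms by (simp add: power2_eq_square)
    then show ?thesis using assms by linarith
  qed
  ultimately show ?thesis by linarith
qed

lemma ln_primorial_le:
  assumes "x > 0"
  shows "ln (real (primorial x)) \<le> x * ln x"
proof -
  have "primorial x \<le> (\<Prod>p\<in>{p. prime p \<and> p \<le> x}. x)"
    unfolding primorial_def by (rule prod_mono) auto
  also have "\<dots> = x ^ card {p. prime p \<and> p \<le> x}" by simp
  also have "\<dots> \<le> x ^ x"
  proof (rule power_increasing)
    have "card {p. prime p \<and> p \<le> x} \<le> card {1..x}"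
      by (rule card_mono) (auto dest: prime_ge_1_nat)
    then show "card {p. prime p \<and> p \<le> x} \<le> x" by simp
  qed (use assms in simp)
  finally have "real (primorial x) \<le> real x ^ x"
    by (metis of_nat_le_iff of_nat_power)
  then have "ln (real (primorial x)) \<le> ln (real x ^ x)"
    using primorial_pos[of x] assms by (subst ln_le_cancel_iff) auto
  also have "\<dots> = x * ln x" using assms by (simp add: ln_realpow)
  finally show ?thesis .
qed

lemma ln_primorial_400: "ln (real (primorial 400)) \<le> 2620"
proof -
  have "ln 400 = ln (400/512) + ln (2 ^ 9 :: real)"
    using ln_mult[of "400/512 :: real" "2 ^ 9"] by simp
  also have "\<dots> \<le> (400/512 - 1) + 9 * (3/4)"
    using ln_le_minus_one[of "400/512"] ln_2_le
    by (intro add_mono) (auto simp: ln_realpow simp del: power_numeral)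
  finally have "400 * ln 400 \<le> (2620::real)" by simp
  then show ?thesis using ln_primorial_le[of 400] by simp
qed

lemma prime_between_large:
  fixes n :: nat
  assumes n: "n \<ge> 200000"
  shows "\<exists>q. prime q \<and> 2 * n < q \<and> q < 3 * n"
proof (rule ccontr)
  assume "\<not> ?thesis"
  then have np: "\<not> q < 3 * n" if "prime q" "2 * n < q" for q using that by blast
  define y where "y = real (3 * n)"
  define z where "z = sqrt y"
  define s where "s = nat \<lfloor>z\<rfloor>"
  define K where "K = real (primorial 400)"
  have y: "y > 0" "y = z\<^sup>2" using n by (auto simp: y_def z_def)
  have z: "z \<ge> 774"
    unfolding z_def by (rule real_le_rsqrt) (use n in \<open>simp add: y_def\<close>)
  have sz: "real s \<le> z" "z < real s + 1" using z by (auto simp: s_def)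
  have "real (3 * n) < real ((s + 1)\<^sup>2)"
    using sz z y(2) by (auto simp: y_def add.commute intro!: power_strict_mono)
  then have s: "3 * n < (s + 1)\<^sup>2" by linarith
  have "((3*n) choose n) \<le> (3*n) ^ s * primorial (3 * n div 2)"
    by (rule binomial_le_primorial[OF _ s]) (use n np in auto)
  then have "4 ^ n * (3 * n) * ((3*n) choose n) \<le> 4 ^ n * (3 * n) * ((3*n) ^ s * primorial (3 * n div 2))"
    by (rule mult_left_mono) simp
  with binomial_ge[of n] n
  have "27 ^ n \<le> 4 ^ n * (3 * n) * ((3*n) ^ s * primorial (3 * n div 2))" by linarith
  then have "real (27 ^ n) \<le> real (4 ^ n * (3 * n) * ((3*n) ^ s * primorial (3 * n div 2)))"
    by (rule of_nat_mono)
  then have "27 ^ n \<le> 4 ^ n * y ^ (s + 1) * real (primorial (3 * n div 2))"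
    by (simp add: y_def)
  also have "\<dots> \<le> 4 ^ n * y ^ (s + 1) * (K * (10/3) ^ (3 * n div 2))"
    using y unfolding K_def by (intro mult_left_mono primorial_le) auto
  finally have "ln (27 ^ n) \<le> ln (4 ^ n * y ^ (s + 1) * (K * (10/3) ^ (3 * n div 2)))"
    using y primorial_pos[of 400] by (subst ln_le_cancel_iff) (auto simp: K_def)
  also have "\<dots> = n * ln 4 + (s + 1) * ln y + ln K + real (3 * n div 2) * ln (10/3)"
    using y primorial_pos[of 400] by (simp add: ln_mult ln_realpow K_def algebra_simps)
  also have "real (3 * n div 2) * ln (10/3) \<le> (3 * n / 2) * ln (10/3)"
    by (intro mult_right_mono) auto
  also have "(s + 1) * ln y \<le> (z + 1) * (2 * ln z)"
    using sz z y by (intro mult_mono) (auto simp: ln_realpow)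
  also have "ln K \<le> 2620" unfolding K_def by (rule ln_primorial_400)
  finally have "n * (ln 27 - ln 4 - 3/2 * ln (10/3)) \<le> (z + 1) * (2 * ln z) + 2620"
    by (simp add: ln_realpow algebra_simps)
  \<comment> \<open>The right-hand side is about \<open>0.104\<close>; for \<open>1/12\<close> the crude bound \<open>exp 1 \<le> 3\<close> is enough.\<close>
  moreover have "1/12 \<le> ln 27 - ln 4 - 3/2 * ln (10/3 :: real)"
  proof -
    have "exp 1 \<le> (3 :: real)" by (rule exp_le)
    also have "(3::real) \<le> ((27/4)^2 / (10/3)^3)^6" by (simp add: power_divide)
    finally have "ln (exp 1) \<le> ln (((27/4)^2 / (10/3)^3)^6 :: real)"
      by (subst ln_le_cancel_iff) auto
    also have "\<dots> = 6 * (2 * (ln 27 - ln 4) - 3 * ln (10/3))"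
      by (simp add: ln_realpow ln_div)
    finally show ?thesis by simp
  qed
  then have "n * (1/12) \<le> n * (ln 27 - ln 4 - 3/2 * ln (10/3 :: real))"
    by (intro mult_left_mono) auto
  ultimately have "n / 12 \<le> (z + 1) * (2 * ln z) + 2620" by linarith
  moreover have "n / 12 = z\<^sup>2 / 36" using y by (simp add: y_def)
  ultimately show False using log_estimate[OF z] by linarith
qed

text \<open>No number among \<open>d, d + 2, d + 4, \<dots>\<close> up to \<open>k\<close> divides \<open>n\<close>.\<close>

function no_odd_divisor :: "nat \<Rightarrow> nat \<Rightarrow> nat \<Rightarrow> bool" where
  "no_odd_divisor d k n =
    (if k < d then True else if n mod d = 0 then False else no_odd_divisor (d + 2) k n)"
  by auto
termination by (relation "measure (\<lambda>(d, k, n). Suc k - d)") auto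

declare no_odd_divisor.simps [simp del]

lemma no_odd_divisorD:
  assumes "no_odd_divisor d k n" "d \<le> e" "e \<le> k" "even (e - d)"
  shows "\<not> e dvd n"
  using assms
proof (induction d k n rule: no_odd_divisor.induct)
  case (1 d k n)
  have nd: "n mod d \<noteq> 0" and rest: "no_odd_divisor (d + 2) k n"
    using 1(2-4) no_odd_divisor.simps[of d k n] by (auto split: if_splits)
  show ?case
  proof (cases "e = d")
    case True
    then show ?thesis using nd by (simp add: dvd_eq_mod_eq_0)
  next
    case False
    then have "e \<ge> d + 2" "even (e - (d + 2))" using 1(3,5) by presburger+
    then show ?thesis using 1(1)[OF _ nd rest] 1(3,4) by auto
  qed
qed

lemma prime_by_trial_division:
  assumes "odd n" "n > 1" "n < (k + 1)\<^sup>2" "no_odd_divisor 3 k n"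
  shows "prime n"
proof (rule ccontr)
  assume "\<not> prime n"
  then obtain a b where ab: "n = a * b" "a \<noteq> 1" "b \<noteq> 1"
    using assms(2) by (auto simp: prime_nat_iff dvd_def)
  have large: "k + 1 \<le> d" if "d dvd n" "d \<noteq> 1" for d
  proof (rule ccontr)
    assume "\<not> k + 1 \<le> d"
    have "odd d" using that assms(1) by (meson dvd_trans)
    then have "d \<ge> 3" "even (d - 3)" using that(2) by presburger+
    then show False
      using no_odd_divisorD[OF assms(4), of d] \<open>\<not> k + 1 \<le> d\<close> that(1) by auto
  qed
  have "(k + 1) * (k + 1) \<le> a * b" by (intro mult_mono large) (use ab in auto)
  then show False using assms(3) ab(1) by (simp add: power2_eq_square)
qed

text \<open>
  Together with 5, 7, 11, 17, 23, 31, 47, 71 these primes form a chain such that for every \<open>n\<close>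
  from 2 to 200000 one of them lies strictly between \<open>2n\<close> and \<open>3n\<close>.
\<close>

lemma prime_chain:
  "prime (107::nat)"
  "prime (157::nat)"
  "prime (233::nat)"
  "prime (349::nat)"
  "prime (523::nat)"
  "prime (773::nat)"
  "prime (1153::nat)"
  "prime (1723::nat)"
  "prime (2579::nat)"
  "prime (3863::nat)"
  "prime (5791::nat)"
  "prime (8681::nat)"
  "prime (13009::nat)"
  "prime (19507::nat)"
  "prime (29251::nat)"
  "prime (43867::nat)"
  "prime (65789::nat)"
  "prime (98669::nat)"
  "prime (147997::nat)"
  "prime (221989::nat)"
  "prime (332951::nat)"
  "prime (499423::nat)"
  subgoal by (rule prime_by_trial_division[of _ 10]; simp add: no_odd_divisor.simps)
  subgoal by (rule prime_by_trial_division[of _ 12]; simp add: no_odd_divisor.simps)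
  subgoal by (rule prime_by_trial_division[of _ 15]; simp add: no_odd_divisor.simps)
  subgoal by (rule prime_by_trial_division[of _ 18]; simp add: no_odd_divisor.simps)
  subgoal by (rule prime_by_trial_division[of _ 22]; simp add: no_odd_divisor.simps)
  subgoal by (rule prime_by_trial_division[of _ 27]; simp add: no_odd_divisor.simps)
  subgoal by (rule prime_by_trial_division[of _ 33]; simp add: no_odd_divisor.simps)
  subgoal by (rule prime_by_trial_division[of _ 41]; simp add: no_odd_divisor.simps)
  subgoal by (rule prime_by_trial_division[of _ 50]; simp add: no_odd_divisor.simps)
  subgoal by (rule prime_by_trial_division[of _ 62]; simp add: no_odd_divisor.simps)
  subgoal by (rule prime_by_trial_division[of _ 76]; simp add: no_odd_divisor.simps)
  subgoal by (rule prime_by_trial_division[of _ 93]; simp add: no_odd_divisor.simps)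
  subgoal by (rule prime_by_trial_division[of _ 114]; simp add: no_odd_divisor.simps)
  subgoal by (rule prime_by_trial_division[of _ 139]; simp add: no_odd_divisor.simps)
  subgoal by (rule prime_by_trial_division[of _ 171]; simp add: no_odd_divisor.simps)
  subgoal by (rule prime_by_trial_division[of _ 209]; simp add: no_odd_divisor.simps)
  subgoal by (rule prime_by_trial_division[of _ 256]; simp add: no_odd_divisor.simps)
  subgoal by (rule prime_by_trial_division[of _ 314]; simp add: no_odd_divisor.simps)
  subgoal by (rule prime_by_trial_division[of _ 384]; simp add: no_odd_divisor.simps)
  subgoal by (rule prime_by_trial_division[of _ 471]; simp add: no_odd_divisor.simps)
  subgoal by (rule prime_by_trial_division[of _ 577]; simp add: no_odd_divisor.simps)
  subgoal by (rule prime_by_trial_division[of _ 706]; simp add: no_odd_divisor.simps)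
  done

text \<open>
  One step along the chain: a prime \<open>q < 3a\<close> that is not between \<open>2n\<close> and \<open>3n\<close>, for some
  \<open>n \<ge> a\<close>, is at most \<open>2n\<close>, which improves the lower bound on \<open>n\<close>.
\<close>

lemma prime_gap_step:
  fixes n :: nat
  assumes "\<nexists>q. prime q \<and> 2 * n < q \<and> q < 3 * n" "prime q" "a \<le> n" "q < 3 * a"
  shows "(q + 1) div 2 \<le> n"
proof -
  have "\<not> 2 * n < q" using assms by (meson less_le_trans mult_le_mono2)
  then show ?thesis by linarith
qed

theorem prime_between_2n_3n:
  fixes n :: nat
  assumes "n \<ge> 2"
  shows "\<exists>q. prime q \<and> 2 * n < q \<and> q < 3 * n"
proof (rule ccontr)
  assume no: "\<not> ?thesis"
  note step = prime_gap_step[OF no]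
  have "prime (5::nat)" "prime (7::nat)" "prime (11::nat)" "prime (17::nat)" "prime (23::nat)" "prime (31::nat)"
    "prime (47::nat)" "prime (71::nat)" by simp_all
  note primes = this prime_chain
  from step[OF primes(1) assms] have "3 \<le> n" by simp
  from step[OF primes(2) this] have "4 \<le> n" by simp
  from step[OF primes(3) this] have "6 \<le> n" by simp
  from step[OF primes(4) this] have "9 \<le> n" by simp
  from step[OF primes(5) this] have "12 \<le> n" by simp
  from step[OF primes(6) this] have "16 \<le> n" by simp
  from step[OF primes(7) this] have "24 \<le> n" by simp
  from step[OF primes(8) this] have "36 \<le> n" by simp
  from step[OF primes(9) this] have "54 \<le> n" by simp
  from step[OF primes(10) this] have "79 \<le> n" by simp
  from step[OF primes(11) this] have "117 \<le> n" by simp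
  from step[OF primes(12) this] have "175 \<le> n" by simp
  from step[OF primes(13) this] have "262 \<le> n" by simp
  from step[OF primes(14) this] have "387 \<le> n" by simp
  from step[OF primes(15) this] have "577 \<le> n" by simp
  from step[OF primes(16) this] have "862 \<le> n" by simp
  from step[OF primes(17) this] have "1290 \<le> n" by simp
  from step[OF primes(18) this] have "1932 \<le> n" by simp
  from step[OF primes(19) this] have "2896 \<le> n" by simp
  from step[OF primes(20) this] have "4341 \<le> n" by simp
  from step[OF primes(21) this] have "6505 \<le> n" by simp
  from step[OF primes(22) this] have "9754 \<le> n" by simp
  from step[OF primes(23) this] have "14626 \<le> n" by simp
  from step[OF primes(24) this] have "21934 \<le> n" by simp
  from step[OF primes(25) this] have "32895 \<le> n" by simp
  from step[OF primes(26) this] have "49335 \<le> n" by simp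
  from step[OF primes(27) this] have "73999 \<le> n" by simp
  from step[OF primes(28) this] have "110995 \<le> n" by simp
  from step[OF primes(29) this] have "166476 \<le> n" by simp
  from step[OF primes(30) this] have "249712 \<le> n" by simp
  then have "n \<ge> 200000" by simp
  with prime_between_large no show False by blast
qed

section \<open>Colourings and cliques\<close>

text \<open>
  Graphs are handled as a vertex set together with an adjacency relation, so that an induced
  subgraph is just a subset of the vertices. Colours are numbers below \<open>k\<close>.
\<close>

definition colorable :: "('a \<Rightarrow> 'a \<Rightarrow> bool) \<Rightarrow> 'a set \<Rightarrow> nat \<Rightarrow> bool" where
  "colorable E S k \<longleftrightarrow> (\<exists>c. (\<forall>v\<in>S. c v < k) \<and> (\<forall>u\<in>S. \<forall>v\<in>S. E u v \<longrightarrow> c u \<noteq> (c v :: nat)))"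

text \<open>Pairwise adjacent vertices.\<close>

definition clique :: "('a \<Rightarrow> 'a \<Rightarrow> bool) \<Rightarrow> 'a set \<Rightarrow> bool" where
  "clique E K \<longleftrightarrow> (\<forall>u\<in>K. \<forall>v\<in>K. u \<noteq> v \<longrightarrow> E u v)"

lemma colorable_mono:
  assumes "colorable E S k" "k \<le> l" "T \<subseteq> S" "\<And>u v. F u v \<Longrightarrow> E u v"
  shows "colorable F T l"
  using assms unfolding colorable_def by (meson order_less_le_trans subsetD)

lemma colorable_by_finite_set:
  assumes "finite T" "\<And>v. v \<in> S \<Longrightarrow> c v \<in> T"
    and "\<And>u v. u \<in> S \<Longrightarrow> v \<in> S \<Longrightarrow> E u v \<Longrightarrow> c u \<noteq> c v"
  shows "colorable E S (card T)"
proof -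
  obtain h where h: "bij_betw h T {0..<card T}"
    using ex_bij_betw_finite_nat[OF assms(1)] by blast
  have "h (c v) < card T" if "v \<in> S" for v
    using h assms(2)[OF that] by (auto dest: bij_betwE)
  moreover have "h (c u) \<noteq> h (c v)" if "u \<in> S" "v \<in> S" "E u v" for u v
    using assms(2,3) that h by (metis bij_betw_def inj_onD)
  ultimately show ?thesis
    unfolding colorable_def by (intro exI[of _ "h \<circ> c"]) auto
qed

text \<open>The largest size of a clique contained in \<open>S\<close> is \<open>m\<close>.\<close>

definition clique_no :: "('a \<Rightarrow> 'a \<Rightarrow> bool) \<Rightarrow> 'a set \<Rightarrow> nat \<Rightarrow> bool" where
  "clique_no E S m \<longleftrightarrow>
    (\<forall>K\<subseteq>S. clique E K \<longrightarrow> card K \<le> m) \<and> (\<exists>K\<subseteq>S. clique E K \<and> card K = m)"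

lemma ex_clique_no:
  assumes "finite S"
  obtains m where "clique_no E S m"
proof -
  define W where "W = {card K | K. K \<subseteq> S \<and> clique E K}"
  have "W \<subseteq> {..card S}" using card_mono[OF assms] by (auto simp: W_def)
  then have finW: "finite W" by (rule finite_subset) simp
  have "{} \<subseteq> S \<and> clique E {}" by (simp add: clique_def)
  then have "W \<noteq> {}" unfolding W_def by blast
  then have "Max W \<in> W" using finW by simp
  have "clique_no E S (Max W)"
    unfolding clique_no_def
  proof (intro conjI allI impI)
    fix K assume "K \<subseteq> S" "clique E K"
    then have "card K \<in> W" unfolding W_def by blast
    then show "card K \<le> Max W" by (rule Max_ge[OF finW])
  next
    show "\<exists>K\<subseteq>S. clique E K \<and> card K = Max W"
      using \<open>Max W \<in> W\<close> unfolding W_def mem_Collect_eq by metis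
  qed
  then show thesis by (rule that)
qed

lemma colorable_one:
  assumes "clique_no E S 1" "\<And>u v. E u v \<Longrightarrow> E v u" "\<And>u. \<not> E u u"
  shows "colorable E S 1"
proof -
  have "\<not> E u v" if "u \<in> S" "v \<in> S" for u v
  proof
    assume "E u v"
    then have "u \<noteq> v" "clique E {u, v}" using assms(2)[of u v] assms(3)[of u] by (auto simp: clique_def)
    moreover have "\<forall>K\<subseteq>S. clique E K \<longrightarrow> card K \<le> 1" using assms(1) by (simp add: clique_no_def)
    moreover have "{u, v} \<subseteq> S" using that by simp
    ultimately have "card {u, v} \<le> 1" by blast
    then show False using \<open>u \<noteq> v\<close> by simp
  qed
  then show ?thesis by (auto simp: colorable_def)
qed

text \<open>A minimal subset that is not \<open>k\<close>-colourable has chromatic number exactly \<open>k + 1\<close>.\<close>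

lemma critical_subset:
  assumes "finite V" "\<not> colorable E V k" "\<And>u. \<not> E u u"
  obtains S where "S \<subseteq> V" "\<not> colorable E S k" "colorable E S (Suc k)"
proof -
  let ?P = "\<lambda>S. S \<subseteq> V \<and> \<not> colorable E S k"
  have "?P V" using assms(2) by simp
  then obtain S where S: "?P S" and min: "\<forall>T. ?P T \<longrightarrow> card S \<le> card T"
    using ex_has_least_nat[of ?P V card] by blast
  then have "S \<subseteq> V" by simp
  then have finS: "finite S" using assms(1) by (rule finite_subset)
  have "S \<noteq> {}" using S by (auto simp: colorable_def)
  then obtain v where v: "v \<in> S" by blast
  then have "card (S - {v}) < card S" using finS by (intro psubset_card_mono) auto
  then have "\<not> ?P (S - {v})" using min by (meson not_le)
  then have "colorable E (S - {v}) k" using \<open>S \<subseteq> V\<close> by blast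
  then obtain c where c: "\<forall>u\<in>S - {v}. c u < k" "\<forall>u\<in>S - {v}. \<forall>w\<in>S - {v}. E u w \<longrightarrow> c u \<noteq> c w"
    unfolding colorable_def by blast
  have "colorable E S (Suc k)"
    unfolding colorable_def
  proof (intro exI conjI ballI impI)
    fix u assume "u \<in> S"
    then show "(if u = v then k else c u) < Suc k" using c(1) by (auto simp: less_Suc_eq)
  next
    fix u w assume "u \<in> S" "w \<in> S" "E u w"
    then show "(if u = v then k else c u) \<noteq> (if w = v then k else c w)"
      using c assms(3)[of v] by (cases "u = v"; cases "w = v") auto
  qed
  then show thesis using S that by blast
qed

lemma colorable_image:
  assumes "inj_on h T" "\<And>u v. u \<in> T \<Longrightarrow> v \<in> T \<Longrightarrow> F (h u) (h v) \<longleftrightarrow> E u v"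
  shows "colorable F (h ` T) k \<longleftrightarrow> colorable E T k"
proof
  assume "colorable F (h ` T) k"
  then obtain c where "\<forall>v\<in>h ` T. c v < k" "\<forall>u\<in>h ` T. \<forall>v\<in>h ` T. F u v \<longrightarrow> c u \<noteq> c v"
    unfolding colorable_def by blast
  then show "colorable E T k"
    unfolding colorable_def using assms(2) by (intro exI[of _ "c \<circ> h"]) simp
next
  assume "colorable E T k"
  then obtain c where c: "\<forall>v\<in>T. c v < k" "\<forall>u\<in>T. \<forall>v\<in>T. E u v \<longrightarrow> c u \<noteq> c v"
    unfolding colorable_def by blast
  define c' where "c' = c \<circ> the_inv_into T h"
  have c': "c' (h v) = c v" if "v \<in> T" for v
    using the_inv_into_f_f[OF assms(1) that] by (simp add: c'_def)
  have "\<forall>v\<in>h ` T. c' v < k" using c(1) c' by simp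
  moreover have "c' (h u) \<noteq> c' (h v)" if "u \<in> T" "v \<in> T" "F (h u) (h v)" for u v
    using c(2) c' assms(2) that by simp
  then have "\<forall>u\<in>h ` T. \<forall>v\<in>h ` T. F u v \<longrightarrow> c' u \<noteq> c' v" by blast
  ultimately show "colorable F (h ` T) k" unfolding colorable_def by blast
qed

lemma clique_image:
  assumes "inj_on h K" "\<And>u v. u \<in> K \<Longrightarrow> v \<in> K \<Longrightarrow> F (h u) (h v) \<longleftrightarrow> E u v"
  shows "clique F (h ` K) \<longleftrightarrow> clique E K"
proof -
  have "(h u \<noteq> h v \<longrightarrow> F (h u) (h v)) \<longleftrightarrow> (u \<noteq> v \<longrightarrow> E u v)" if "u \<in> K" "v \<in> K" for u v
    using assms(2)[OF that] inj_on_eq_iff[OF assms(1) that] by simp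
  then show ?thesis by (simp add: clique_def)
qed

lemma clique_no_image:
  assumes "inj_on h T" "\<And>u v. u \<in> T \<Longrightarrow> v \<in> T \<Longrightarrow> F (h u) (h v) \<longleftrightarrow> E u v"
  shows "clique_no F (h ` T) m \<longleftrightarrow> clique_no E T m"
proof -
  have K: "card (h ` K) = card K" "clique F (h ` K) \<longleftrightarrow> clique E K" if "K \<subseteq> T" for K
  proof -
    have inj: "inj_on h K" using assms(1) that by (rule inj_on_subset)
    then show "card (h ` K) = card K" by (rule card_image)
    show "clique F (h ` K) \<longleftrightarrow> clique E K"
      by (rule clique_image[OF inj]) (use assms(2) that in blast)
  qed
  have all: "(\<forall>L\<subseteq>h ` T. P L) \<longleftrightarrow> (\<forall>K\<subseteq>T. P (h ` K))" for P
    by (rule all_subset_image)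
  have ex: "(\<exists>L\<subseteq>h ` T. P L) \<longleftrightarrow> (\<exists>K\<subseteq>T. P (h ` K))" for P
    using all_subset_image[of h T "\<lambda>L. \<not> P L"] by blast
  show ?thesis
    unfolding clique_no_def all ex by (simp add: K cong: conj_cong imp_cong)
qed

lemma binomial_le_binomial:
  fixes a b :: nat
  assumes "a \<le> b"
  shows "a choose k \<le> b choose k"
proof (rule lift_Suc_mono_le[OF _ assms])
  show "n choose k \<le> Suc n choose k" for n by (cases k) simp_all
qed

text \<open>The triples \<open>(a, c, i)\<close> with \<open>i < c \<le> a \<le> w\<close> and \<open>a \<ge> 1\<close>; they serve as colours.\<close>

lemma card_triples:
  "card (SIGMA a:{1..w}. SIGMA c:{1..a}. {..<c}) = (w + 2) choose 3"
proof -
  have 1: "(\<Sum>c=1..a. c) = Suc a choose 2" for a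
    by (induction a) (auto simp: eval_nat_numeral)
  have 2: "(\<Sum>a=1..w. Suc a choose 2) = (w + 2) choose 3"
    by (induction w) (auto simp: eval_nat_numeral)
  show ?thesis using 1 2 by simp
qed

section \<open>Ranks of sets of residues modulo a prime\<close>

lemma shift_inj:
  fixes p r :: int
  assumes "J \<subseteq> {0..<p}"
  shows "inj_on (\<lambda>y. (y - r) mod p) J"
proof (rule inj_onI)
  fix x y assume "x \<in> J" "y \<in> J" and eq: "(x - r) mod p = (y - r) mod p"
  then have bounds: "0 \<le> x" "x < p" "0 \<le> y" "y < p" using assms by auto
  have "p dvd (x - r) - (y - r)" using eq unfolding mod_eq_dvd_iff .
  then have "[x = y] (mod p)" by (simp add: cong_iff_dvd_diff)
  with bounds show "x = y" by (rule cong_less_imp_eq_int)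
qed

text \<open>
  A set \<open>J\<close> of \<open>c\<close> residues, \<open>0 < c < p\<close>, has a unique ``centre of mass'', the residue \<open>s\<close> with
  \<open>c * s = \<Sum>J\<close> modulo \<open>p\<close>. It moves along when \<open>J\<close> is rotated, so \<open>J - s\<close> depends on \<open>J\<close> only up to
  rotation. The rank of a set \<open>J\<close> that contains 0 is the place of \<open>- s\<close>, the image of 0, in
  \<open>J - s\<close>, where residues are represented by \<open>0, \<dots>, p - 1\<close>.
\<close>

definition center :: "int \<Rightarrow> int set \<Rightarrow> int" where
  "center p J = (SOME s. 0 \<le> s \<and> s < p \<and> p dvd int (card J) * s - \<Sum>J)"

definition cyclic_rank :: "int \<Rightarrow> int set \<Rightarrow> nat" where
  "cyclic_rank p J =
    card {y \<in> (\<lambda>x. (x - center p J) mod p) ` J. y < (- center p J) mod p}"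

lemma card_less_inj:
  fixes T :: "int set"
  assumes "finite T" "s \<in> T" "t \<in> T" "card {y\<in>T. y < s} = card {y\<in>T. y < t}"
  shows "s = t"
proof -
  have "\<not> a < b" if "a \<in> T" "card {y\<in>T. y < a} = card {y\<in>T. y < b}" for a b
  proof
    assume "a < b"
    then have "{y\<in>T. y < a} \<subset> {y\<in>T. y < b}" using that(1) by auto
    then show False using psubset_card_mono[of "{y\<in>T. y < b}" "{y\<in>T. y < a}"] assms(1) that(2) by auto
  qed
  then show ?thesis using assms(2-4) linorder_less_linear[of s t] by auto
qed

context
  fixes p :: int
  assumes p: "prime p"
begin

lemma p_pos: "p > 0" using p prime_gt_0_int by blast

lemma center_props:
  assumes "0 < card J" "int (card J) < p"
  shows "0 \<le> center p J" "center p J < p" "p dvd int (card J) * center p J - \<Sum>J"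
proof -
  have "\<not> p dvd int (card J)" using zdvd_not_zless[of "int (card J)" p] assms by simp
  then have "coprime (int (card J)) p"
    using prime_imp_coprime[OF p] by (subst coprime_commute)
  then obtain x where "[int (card J) * x = 1] (mod p)" using cong_solve_coprime_int by blast
  then have "[int (card J) * x * \<Sum>J = 1 * \<Sum>J] (mod p)" by (rule cong_mult) simp
  then have "[int (card J) * ((x * \<Sum>J) mod p) = \<Sum>J] (mod p)"
    by (simp add: cong_def mod_mult_right_eq mult.assoc)
  then have "p dvd int (card J) * ((x * \<Sum>J) mod p) - \<Sum>J"
    by (simp add: cong_iff_dvd_diff)
  then have "\<exists>s. 0 \<le> s \<and> s < p \<and> p dvd int (card J) * s - \<Sum>J"
    using p_pos by (intro exI[of _ "(x * \<Sum>J) mod p"]) auto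
  from someI_ex[OF this] show "0 \<le> center p J" "center p J < p" "p dvd int (card J) * center p J - \<Sum>J"
    unfolding center_def by auto
qed

lemma center_shift:
  assumes "J \<subseteq> {0..<p}" "0 < card J" "int (card J) < p"
  shows "p dvd center p ((\<lambda>y. (y - r) mod p) ` J) - (center p J - r)"
proof -
  let ?f = "\<lambda>y. (y - r) mod p"
  define c where "c = int (card J)"
  have inj: "inj_on ?f J" by (rule shift_inj) fact
  have card: "card (?f ` J) = card J" by (rule card_image) fact
  have "\<Sum>(?f ` J) = (\<Sum>y\<in>J. ?f y)" by (rule sum.reindex_cong[OF inj]) auto
  moreover have "[(\<Sum>y\<in>J. ?f y) = (\<Sum>y\<in>J. y - r)] (mod p)"
    by (rule cong_sum) (simp add: cong_def)
  moreover have "(\<Sum>y\<in>J. y - r) = \<Sum>J - c * r" by (simp add: sum_subtractf c_def)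
  ultimately have 1: "p dvd \<Sum>(?f ` J) - (\<Sum>J - c * r)"
    by (simp add: cong_iff_dvd_diff)
  have 2: "p dvd c * center p J - \<Sum>J"
    unfolding c_def using assms by (intro center_props)
  have 3: "p dvd c * center p (?f ` J) - \<Sum>(?f ` J)"
    unfolding c_def using center_props(3)[of "?f ` J"] assms card by simp
  have "c * (center p (?f ` J) - (center p J - r)) =
     (c * center p (?f ` J) - \<Sum>(?f ` J)) - (c * center p J - \<Sum>J)
     + (\<Sum>(?f ` J) - (\<Sum>J - c * r))" by (simp add: algebra_simps)
  then have "p dvd c * (center p (?f ` J) - (center p J - r))"
    using dvd_add[OF dvd_diff[OF 3 2] 1] by simp
  moreover have "\<not> p dvd c" using zdvd_not_zless[of c p] assms by (simp add: c_def)
  ultimately show ?thesis using p prime_dvd_mult_iff by blast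
qed

lemma cyclic_rank_less:
  assumes "0 \<in> J" "finite J"
  shows "cyclic_rank p J < card J"
proof -
  let ?s = "center p J"
  let ?T = "(\<lambda>x. (x - ?s) mod p) ` J"
  have "(- ?s) mod p \<in> ?T" using assms(1) by (intro image_eqI[of _ _ 0]) auto
  then have "{y\<in>?T. y < (- ?s) mod p} \<subset> ?T" by auto
  then have "cyclic_rank p J < card ?T"
    unfolding cyclic_rank_def using assms(2) by (intro psubset_card_mono) auto
  also have "\<dots> \<le> card J" using assms(2) by (rule card_image_le)
  finally show ?thesis .
qed

text \<open>Rotating \<open>J\<close> so that another of its elements becomes 0 changes the rank.\<close>

lemma cyclic_rank_shift:
  assumes "J \<subseteq> {0..<p}" "int (card J) < p" "0 \<in> J" "r \<in> J" "r \<noteq> 0"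
  shows "cyclic_rank p ((\<lambda>y. (y - r) mod p) ` J) \<noteq> cyclic_rank p J"
proof
  let ?f = "\<lambda>y. (y - r) mod p"
  define s s' where "s = center p J" and "s' = center p (?f ` J)"
  define T where "T = (\<lambda>x. (x - s) mod p) ` J"
  have fin: "finite J" using assms(1) finite_subset by blast
  then have "0 < card J" using assms(3) by (auto simp: card_gt_0_iff)
  then have s: "p dvd s' - (s - r)" unfolding s_def s'_def by (intro center_shift assms)
  have same: "(?f x - s') mod p = (x - s) mod p" for x
  proof -
    have "(?f x - s') mod p = (x - r - s') mod p" by (simp add: mod_diff_left_eq)
    also have "\<dots> = (x - s) mod p"
      unfolding mod_eq_dvd_iff using s by (auto dest: dvd_minus_iff[THEN iffD2] simp: algebra_simps)
    finally show ?thesis .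
  qed
  then have T': "T = (\<lambda>x. (x - s') mod p) ` ?f ` J" unfolding T_def image_image by simp
  have t: "(- s) mod p \<in> T" unfolding T_def using assms(3) by (intro image_eqI[of _ _ 0]) auto
  have t': "(- s') mod p \<in> T" unfolding T'
    using assms(4) by (intro image_eqI[of _ _ 0] image_eqI[of _ _ r]) auto
  assume "cyclic_rank p (?f ` J) = cyclic_rank p J"
  then have "card {y\<in>T. y < (- s') mod p} = card {y\<in>T. y < (- s) mod p}"
    unfolding cyclic_rank_def s_def[symmetric] s'_def[symmetric] T'[symmetric] T_def[symmetric] .
  then have "(- s') mod p = (- s) mod p"
    using card_less_inj[OF _ t' t] fin by (simp add: T_def)
  then have "p dvd s - s'" by (simp add: mod_eq_dvd_iff)
  then have "p dvd (s' - (s - r)) + (s - s')" using s by (rule dvd_add[rotated])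
  then have "p dvd r" by simp
  moreover have "0 \<le> r" "r < p" using assms(1,4) by auto
  ultimately show False using assms(5) zdvd_not_zless[of r p] by linarith
qed

end

section \<open>Orders with an additive distance\<close>

text \<open>
  \<open>lt\<close> stands for reachability in an acyclic digraph with unique directed paths, and \<open>d u v\<close> for
  the length of the path from \<open>u\<close> to \<open>v\<close>; the value of \<open>d\<close> at distinct vertices not related by
  \<open>lt\<close> is irrelevant. Irreflexivity of \<open>lt\<close> is not required: the distance from a vertex to itself is
  0, and the distance 0 never gives an edge below.
\<close>

locale distance_order =
  fixes lt :: "'a \<Rightarrow> 'a \<Rightarrow> bool" and d :: "'a \<Rightarrow> 'a \<Rightarrow> int"
  assumes lt_trans: "lt u v \<Longrightarrow> lt v w \<Longrightarrow> lt u w"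
    and d_add: "lt u v \<Longrightarrow> lt v w \<Longrightarrow> d u w = d u v + d v w"
    and d_self: "d u u = 0"
begin

text \<open>Comparable vertices whose distance has property \<open>P\<close>.\<close>

definition adj :: "(int \<Rightarrow> bool) \<Rightarrow> 'a \<Rightarrow> 'a \<Rightarrow> bool" where
  "adj P u v \<longleftrightarrow> lt u v \<and> P (d u v) \<or> lt v u \<and> P (d v u)"

lemma adj_sym: "adj P u v \<longleftrightarrow> adj P v u"
  by (auto simp: adj_def)

text \<open>On a clique, which is a chain, the distance is a difference of positions.\<close>

lemma potential:
  assumes "clique (adj P) K" "b \<in> K"
  obtains pos where "pos b = 0"
    "\<And>x y. x \<in> K \<Longrightarrow> y \<in> K \<Longrightarrow> lt x y \<Longrightarrow> pos y - pos x = d x y"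
proof -
  define pos where "pos x = (if lt b x then d b x else - d x b)" for x
  have "pos b = 0" by (simp add: pos_def d_self)
  have tot: "lt b z \<or> z = b \<or> lt z b" if "z \<in> K" for z
    using assms that by (auto simp: clique_def adj_def)
  have "pos y - pos x = d x y" if xy: "x \<in> K" "y \<in> K" "lt x y" for x y
  proof -
    consider "lt b x" | "\<not> lt b x" "x = b" | "\<not> lt b x" "lt x b" "lt b y"
      | "\<not> lt b x" "lt x b" "\<not> lt b y" "y = b" | "\<not> lt b x" "lt x b" "\<not> lt b y" "lt y b"
      using tot xy by blast
    then show ?thesis
    proof cases
      case 1
      then show ?thesis using lt_trans[OF 1 xy(3)] d_add[OF 1 xy(3)] by (simp add: pos_def)
    next
      case 2
      then show ?thesis using xy(3) by (simp add: pos_def d_self)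
    next
      case 3
      then show ?thesis using d_add[of x b y] by (simp add: pos_def)
    next
      case 4
      then show ?thesis by (simp add: pos_def d_self)
    next
      case 5
      then show ?thesis using d_add[OF xy(3) 5(4)] by (simp add: pos_def)
    qed
  qed
  with \<open>pos b = 0\<close> show thesis by (rule that)
qed

section \<open>Colouring sets of bounded clique number\<close>

text \<open>
  Throughout, \<open>S\<close> is a set in which cliques of the graph ``distance not divisible by \<open>p\<close>'' have
  size at most \<open>w < p\<close>.
\<close>

context
  fixes p :: int and S :: "'a set" and w :: nat
  assumes p: "prime p" and finS: "finite S"
    and w: "\<And>K. K \<subseteq> S \<Longrightarrow> clique (adj (\<lambda>r. \<not> p dvd r)) K \<Longrightarrow> card K \<le> w"
    and wp: "int w < p"
begin

text \<open>Cliques in \<open>S\<close> with greatest element \<open>v\<close>.\<close>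

definition top_clique :: "'a \<Rightarrow> 'a set \<Rightarrow> bool" where
  "top_clique v K \<longleftrightarrow> K \<subseteq> S \<and> v \<in> K \<and> (\<forall>x\<in>K. x \<noteq> v \<longrightarrow> lt x v) \<and> clique (adj (\<lambda>r. \<not> p dvd r)) K"

text \<open>Positions of the elements of \<open>K\<close> on the circle, with \<open>v\<close> at 0.\<close>

definition residues_of :: "'a \<Rightarrow> 'a set \<Rightarrow> int set" where
  "residues_of v K = (\<lambda>x. (- d x v) mod p) ` K"

text \<open>The position sets of all cliques with top \<open>v\<close>.\<close>

definition residue_sets :: "'a \<Rightarrow> int set set" where
  "residue_sets v = {residues_of v K | K. top_clique v K}"

text \<open>The largest size of a clique with top \<open>v\<close>.\<close>

definition height :: "'a \<Rightarrow> nat" where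
  "height v = Max (card ` residue_sets v)"

text \<open>The positions common to all largest cliques with top \<open>v\<close>.\<close>

definition core :: "'a \<Rightarrow> int set" where
  "core v = \<Inter>{A \<in> residue_sets v. card A = height v}"

lemma residues_inj:
  assumes "top_clique v K"
  shows "inj_on (\<lambda>x. (- d x v) mod p) K"
proof -
  have *: "(- d x v) mod p \<noteq> (- d y v) mod p" if "x \<in> K" "y \<in> K" "lt x y" "\<not> p dvd d x y" for x y
  proof
    assume "(- d x v) mod p = (- d y v) mod p"
    then have "p dvd - (d x v - d y v)" by (simp add: mod_eq_dvd_iff)
    then have "p dvd d x v - d y v" by (simp only: dvd_minus_iff)
    moreover have "d x v = d x y + d y v"
      using assms that d_add[of x y v] d_self[of v] by (cases "y = v") (auto simp: top_clique_def)
    ultimately show False using that(4) by simp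
  qed
  show ?thesis
  proof (rule inj_onI, rule ccontr)
    fix x y assume xy: "x \<in> K" "y \<in> K" "(- d x v) mod p = (- d y v) mod p" "x \<noteq> y"
    then have "adj (\<lambda>r. \<not> p dvd r) x y" using assms by (auto simp: top_clique_def clique_def)
    then show False using *[of x y] *[of y x] xy by (auto simp: adj_def)
  qed
qed

lemma residue_setsD:
  assumes "A \<in> residue_sets v"
  shows "A \<subseteq> {0..<p}" "0 \<in> A" "card A \<le> w"
proof -
  obtain K where K: "A = residues_of v K" "top_clique v K"
    using assms by (auto simp: residue_sets_def)
  show "A \<subseteq> {0..<p}" using K(1) p_pos[OF p] by (auto simp: residues_of_def)
  show "0 \<in> A"
    unfolding K(1) residues_of_def
    using K(2) by (intro image_eqI[of _ _ v]) (simp_all add: top_clique_def d_self)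
  have "card A = card K"
    unfolding K(1) residues_of_def by (rule card_image[OF residues_inj[OF K(2)]])
  also have "\<dots> \<le> w" using K(2) w by (auto simp: top_clique_def)
  finally show "card A \<le> w" .
qed

lemma finite_residue_sets: "finite (residue_sets v)"
proof (rule finite_subset)
  show "residue_sets v \<subseteq> Pow {0..<p}" using residue_setsD(1) by blast
qed simp

lemma residue_sets_nonempty:
  assumes "v \<in> S"
  shows "residue_sets v \<noteq> {}"
proof -
  have "top_clique v {v}" using assms by (auto simp: top_clique_def clique_def)
  then show ?thesis by (auto simp: residue_sets_def)
qed

lemma card_le_height: "A \<in> residue_sets v \<Longrightarrow> card A \<le> height v"
  unfolding height_def by (rule Max_ge) (simp_all add: finite_residue_sets)

lemma height_attained:
  assumes "v \<in> S"
  obtains A where "A \<in> residue_sets v" "card A = height v"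
proof -
  have "height v \<in> card ` residue_sets v"
    unfolding height_def using residue_sets_nonempty[OF assms]
    by (intro Max_in) (simp_all add: finite_residue_sets)
  then show thesis using that by auto
qed

lemma core_props:
  assumes "v \<in> S"
  shows "core v \<subseteq> {0..<p}" "0 \<in> core v" "card (core v) \<le> height v" "height v \<le> w"
    "1 \<le> card (core v)" "finite (core v)"
proof -
  obtain A where A: "A \<in> residue_sets v" "card A = height v"
    using height_attained[OF assms] .
  have sub: "core v \<subseteq> A" using A by (auto simp: core_def)
  have finA: "finite A" using residue_setsD(1)[OF A(1)] finite_subset by blast
  show "core v \<subseteq> {0..<p}" using sub residue_setsD(1)[OF A(1)] by blast
  show 0: "0 \<in> core v" using residue_setsD(2) by (auto simp: core_def)
  show "card (core v) \<le> height v" using card_mono[OF finA sub] A by simp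
  show "height v \<le> w" using residue_setsD(3)[OF A(1)] A by simp
  show "finite (core v)" using sub finA by (rule finite_subset)
  then show "1 \<le> card (core v)" using 0 by (auto simp: Suc_le_eq card_gt_0_iff)
qed

text \<open>
  Given an edge \<open>u v\<close> of residue \<open>r\<close> and a clique with top \<open>u\<close>, drop the element at position \<open>r\<close>
  (if any) and add \<open>v\<close>, which has this position, as the new top.
\<close>

lemma residue_sets_step:
  assumes "v \<in> S" "lt u v" "\<not> p dvd d u v" "A \<in> residue_sets u"
  shows "(\<lambda>y. (y - d u v mod p) mod p) ` insert (d u v mod p) A \<in> residue_sets v"
proof -
  define r where "r = d u v mod p"
  obtain K where K: "A = residues_of u K" "top_clique u K"
    using assms(4) by (auto simp: residue_sets_def)
  define K0 where "K0 = {x\<in>K. (- d x u) mod p \<noteq> r}"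
  have dx: "lt x v \<and> d x v = d x u + d u v" if "x \<in> K" for x
    using that K(2) assms(2) lt_trans[of x u v] d_add[of x u v] d_self[of u] by (cases "x = u") (auto simp: top_clique_def)
  have res: "(- d x v) mod p = ((- d x u) mod p - r) mod p" if "x \<in> K" for x
    using dx[OF that] by (simp add: r_def mod_diff_eq)
  have nd: "\<not> p dvd d x v" if "x \<in> K0" for x
  proof
    assume "p dvd d x v"
    then have "p dvd - (- d x u - d u v)" using dx that by (simp add: K0_def add.commute)
    then have "p dvd - d x u - d u v" by (simp only: dvd_minus_iff)
    then have "(- d x u) mod p = r" unfolding r_def by (simp add: mod_eq_dvd_iff)
    then show False using that by (simp add: K0_def)
  qed
  have "clique (adj (\<lambda>r. \<not> p dvd r)) (insert v K0)"
    unfolding clique_def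
  proof (intro ballI impI)
    fix x y assume xy: "x \<in> insert v K0" "y \<in> insert v K0" "x \<noteq> y"
    have v: "adj (\<lambda>r. \<not> p dvd r) z v" if "z \<in> K0" for z
      using nd[OF that] dx that by (auto simp: adj_def K0_def)
    have "adj (\<lambda>r. \<not> p dvd r) x y" if "x \<in> K0" "y \<in> K0"
      using K(2) that xy(3) by (auto simp: top_clique_def clique_def K0_def)
    then show "adj (\<lambda>r. \<not> p dvd r) x y" using xy v adj_sym by blast
  qed
  then have "top_clique v (insert v K0)"
    using K(2) assms(1) dx by (auto simp: top_clique_def K0_def)
  moreover have "residues_of v (insert v K0) = (\<lambda>y. (y - r) mod p) ` insert r A"
  proof -
    have "residues_of v (insert v K0) = insert 0 ((\<lambda>x. ((- d x u) mod p - r) mod p) ` K0)"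
      using res d_self[of v] by (auto simp: residues_of_def K0_def)
    also have "\<dots> = insert 0 ((\<lambda>x. ((- d x u) mod p - r) mod p) ` K)"
      by (auto simp: K0_def)
    also have "\<dots> = (\<lambda>y. (y - r) mod p) ` insert r A"
      by (simp add: K(1) residues_of_def image_image)
    finally show ?thesis .
  qed
  ultimately show ?thesis unfolding residue_sets_def r_def by auto
qed

text \<open>
  If the height does not grow along the edge, then a largest clique with top \<open>u\<close> contains an
  element at the position of \<open>v\<close>, so the exchange turns it into a largest clique with top \<open>v\<close>.
\<close>

lemma core_step:
  assumes "u \<in> S" "v \<in> S" "lt u v" "\<not> p dvd d u v" "height u = height v"
  shows "d u v mod p \<in> core u" "core v \<subseteq> (\<lambda>y. (y - d u v mod p) mod p) ` core u"
proof -
  define r where "r = d u v mod p"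
  let ?f = "\<lambda>y. (y - r) mod p"
  have r: "0 \<le> r" "r < p" using p_pos[OF p] by (auto simp: r_def)
  have max: "r \<in> A \<and> ?f ` A \<in> residue_sets v \<and> card (?f ` A) = height v"
    if A: "A \<in> residue_sets u" "card A = height u" for A
  proof -
    have Ap: "A \<subseteq> {0..<p}" by (rule residue_setsD(1)[OF A(1)])
    then have sub: "insert r A \<subseteq> {0..<p}" using r by simp
    have fin: "finite A" using Ap by (rule finite_subset) simp
    have in_v: "?f ` insert r A \<in> residue_sets v"
      unfolding r_def by (rule residue_sets_step) (use assms A in auto)
    have "card (?f ` insert r A) = card (insert r A)"
      by (rule card_image[OF shift_inj[OF sub]])
    then have "card (insert r A) \<le> card A"
      using card_le_height[OF in_v] A(2) assms(5) by linarith
    then have "r \<in> A" using card_insert_disjoint[OF fin, of r] by linarith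
    then have "insert r A = A" by (rule insert_absorb)
    then show ?thesis
      using \<open>r \<in> A\<close> in_v \<open>card (?f ` insert r A) = _\<close> A(2) assms(5) by simp
  qed
  have "r \<in> core u" unfolding core_def
  proof (rule InterI)
    fix A assume "A \<in> {A \<in> residue_sets u. card A = height u}"
    then have "A \<in> residue_sets u" "card A = height u" by simp_all
    from max[OF this] show "r \<in> A" by (rule conjunct1)
  qed
  then show "d u v mod p \<in> core u" by (simp only: r_def)
  show "core v \<subseteq> (\<lambda>y. (y - d u v mod p) mod p) ` core u"
  proof
    fix y assume y: "y \<in> core v"
    have "y \<in> {0..<p}" using core_props(1)[OF assms(2)] y by blast
    then have yp: "y mod p = y" by simp
    have "(y + r) mod p \<in> A" if A: "A \<in> residue_sets u" "card A = height u" for A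
    proof -
      have "?f ` A \<in> residue_sets v" "card (?f ` A) = height v" using max[OF A] by simp_all
      then have "y \<in> ?f ` A" using y unfolding core_def by blast
      then obtain z where z: "z \<in> A" "y = (z - r) mod p" by auto
      have "(y + r) mod p = z mod p" unfolding z(2) by (simp add: mod_add_left_eq)
      moreover have "z \<in> {0..<p}" using residue_setsD(1)[OF A(1)] z(1) by blast
      ultimately show ?thesis using z by simp
    qed
    then have "(y + r) mod p \<in> core u" unfolding core_def by blast
    moreover have "y = ((y + r) mod p - r) mod p" using yp by (simp add: mod_diff_left_eq)
    ultimately show "y \<in> (\<lambda>y. (y - d u v mod p) mod p) ` core u"
      unfolding r_def by blast
  qed
qed

lemma colorable_full: "colorable (adj (\<lambda>r. \<not> p dvd r)) S ((w + 2) choose 3)"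
proof -
  define col where "col v = (height v, card (core v), cyclic_rank p (core v))" for v
  have *: "col u \<noteq> col v" if uv: "u \<in> S" "v \<in> S" "lt u v" "\<not> p dvd d u v" for u v
  proof
    assume eq: "col u = col v"
    define r where "r = d u v mod p"
    note cs = core_step[OF uv, folded r_def]
    have h: "height u = height v" using eq by (simp add: col_def)
    have "card ((\<lambda>y. (y - r) mod p) ` core u) = card (core u)"
      by (rule card_image[OF shift_inj[OF core_props(1)[OF uv(1)]]])
    then have "core v = (\<lambda>y. (y - r) mod p) ` core u"
      using cs(2)[OF h] eq core_props(6)[OF uv(1)] by (intro card_subset_eq) (auto simp: col_def)
    moreover have "r \<noteq> 0" using uv(4) by (auto simp: r_def)
    moreover have "int (card (core u)) < p"
      using core_props(3,4)[OF uv(1)] wp by linarith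
    ultimately have "cyclic_rank p (core v) \<noteq> cyclic_rank p (core u)"
      using cyclic_rank_shift[OF p core_props(1)[OF uv(1)] _ core_props(2)[OF uv(1)] cs(1)[OF h]] by simp
    then show False using eq by (simp add: col_def)
  qed
  have "colorable (adj (\<lambda>r. \<not> p dvd r)) S (card (SIGMA a:{1..w}. SIGMA c:{1..a}. {..<c}))"
  proof (rule colorable_by_finite_set)
    fix v assume v: "v \<in> S"
    show "col v \<in> (SIGMA a:{1..w}. SIGMA c:{1..a}. {..<c})"
      using core_props[OF v] cyclic_rank_less[OF p, of "core v"] by (auto simp: col_def)
  next
    fix u v assume "u \<in> S" "v \<in> S" "adj (\<lambda>r. \<not> p dvd r) u v"
    then show "col u \<noteq> col v" using *[of u v] *[of v u] by (auto simp: adj_def)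
  qed auto
  then show ?thesis unfolding card_triples .
qed

end

section \<open>Joining vertices at short circular distance\<close>

text \<open>\<open>r\<close> is a nonzero residue at circular distance less than \<open>n\<close> from 0.\<close>

definition short :: "int \<Rightarrow> int \<Rightarrow> int \<Rightarrow> bool" where
  "short p n r \<longleftrightarrow> r mod p \<in> {1..n-1} \<union> {p-n+1..p-1}"

lemma short_minus:
  assumes "0 < p"
  shows "short p n (- r) \<longleftrightarrow> short p n r"
proof -
  obtain m where m: "m = r mod p" by simp
  have "0 \<le> m" "m < p" using assms by (simp_all add: m)
  moreover have "(- r) mod p = (if m = 0 then 0 else p - m)"
    by (simp add: m zmod_zminus1_eq_if)
  ultimately show ?thesis unfolding short_def m[symmetric] by auto
qed

lemma short_imp_not_dvd: "n \<le> p \<Longrightarrow> short p n r \<Longrightarrow> \<not> p dvd r"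
  by (auto simp: short_def dvd_eq_mod_eq_0)

text \<open>
  With one element of the clique at position 0, the others lie in \<open>(0, n)\<close> or in \<open>(p - n, p)\<close>.
  The map \<open>f\<close> below superposes these two intervals. It is injective because positions that
  differ by \<open>p - n\<close> are at circular distance at least \<open>n\<close>.
\<close>

lemma card_short_clique:
  assumes "0 < n" "2 * n \<le> p" "clique (adj (short p n)) K"
  shows "int (card K) \<le> n"
proof (cases "K = {}")
  case True
  then show ?thesis using assms by simp
next
  case False
  then obtain b where b: "b \<in> K" by blast
  obtain pos where pos: "pos b = 0"
    "\<And>x y. x \<in> K \<Longrightarrow> y \<in> K \<Longrightarrow> lt x y \<Longrightarrow> pos y - pos x = d x y"
    using potential[OF assms(3) b] by metis
  have p: "p > 0" using assms by simp
  have diff: "short p n (pos y - pos x)" if "x \<in> K" "y \<in> K" "x \<noteq> y" for x y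
  proof -
    have "adj (short p n) x y" using assms(3) that by (auto simp: clique_def)
    then show ?thesis
      using pos(2)[of x y] pos(2)[of y x] that short_minus[OF p, of n "pos x - pos y"]
      by (auto simp: adj_def)
  qed
  define f where "f x = (if pos x mod p < n then pos x mod p else pos x mod p - (p - n))" for x
  have "f ` K \<subseteq> {0..<n}"
  proof
    fix z assume "z \<in> f ` K"
    then obtain x where x: "x \<in> K" "z = f x" by blast
    have "pos x mod p = 0 \<or> pos x mod p \<in> {1..n-1} \<union> {p-n+1..p-1}"
      using diff[OF b x(1)] pos(1) by (cases "x = b") (auto simp: short_def)
    then show "z \<in> {0..<n}" using x(2) assms by (auto simp: f_def)
  qed
  moreover have "inj_on f K"
  proof (rule inj_onI, rule ccontr)
    fix x y assume xy: "x \<in> K" "y \<in> K" "f x = f y" "x \<noteq> y"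
    have "(pos y - pos x) mod p = (pos y mod p - pos x mod p) mod p" by (simp add: mod_diff_eq)
    then have s: "(pos y mod p - pos x mod p) mod p \<in> {1..n-1} \<union> {p-n+1..p-1}"
      using diff[OF xy(1,2,4)] by (simp add: short_def)
    have "pos y mod p - pos x mod p \<in> {0, p - n, n - p}"
      using xy(3) by (auto simp: f_def split: if_splits)
    moreover have "(p - n) mod p = p - n" using assms by (intro mod_pos_pos_trivial) auto
    moreover have "(n - p) mod p = n mod p" by simp
    moreover have "n mod p = n" using assms by (intro mod_pos_pos_trivial) auto
    ultimately show False using s assms by fastforce
  qed
  ultimately have "card K \<le> card {0..<n}" by (intro card_inj_on_le) auto
  then show ?thesis using assms(1) by simp
qed

lemma card_shifts:
  fixes p n a :: int
  assumes "0 \<le> n" "n \<le> p" "0 < p"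
  shows "card {t\<in>{0..<p}. (a + t) mod p < n} = nat n"
proof -
  have "bij_betw (\<lambda>t. (a + t) mod p) {t\<in>{0..<p}. (a + t) mod p < n} {0..<n}"
  proof (rule bij_betw_byWitness[where f' = "\<lambda>s. (s - a) mod p"])
    show "\<forall>t\<in>{t\<in>{0..<p}. (a + t) mod p < n}. ((a + t) mod p - a) mod p = t"
      by (auto simp: mod_diff_left_eq mod_pos_pos_trivial)
    show "\<forall>s\<in>{0..<n}. (a + (s - a) mod p) mod p = s"
      using assms by (auto simp: mod_add_right_eq mod_pos_pos_trivial)
    show "(\<lambda>t. (a + t) mod p) ` {t\<in>{0..<p}. (a + t) mod p < n} \<subseteq> {0..<n}"
      using assms by auto
    show "(\<lambda>s. (s - a) mod p) ` {0..<n} \<subseteq> {t\<in>{0..<p}. (a + t) mod p < n}"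
      using assms by (auto simp: mod_add_right_eq mod_pos_pos_trivial)
  qed
  then have "card {t\<in>{0..<p}. (a + t) mod p < n} = card {0..<n}" by (rule bij_betw_same_card)
  then show ?thesis by simp
qed

text \<open>
  The elements of a clique whose positions lie in an arc of \<open>n\<close> consecutive residues form a clique
  for short distances. On average over the \<open>p\<close> arcs there are \<open>n |K| / p\<close> of them.
\<close>

lemma large_short_clique:
  assumes "0 < n" "n \<le> p" "finite K" "clique (adj (\<lambda>r. \<not> p dvd r)) K"
  obtains L where "L \<subseteq> K" "clique (adj (short p n)) L" "int (card K) * n \<le> int (card L) * p"
proof (cases "K = {}")
  case True
  then show ?thesis using that[of "{}"] by (simp add: clique_def)
next
  case False
  then obtain b where b: "b \<in> K" by blast
  obtain pos where pos: "\<And>x y. x \<in> K \<Longrightarrow> y \<in> K \<Longrightarrow> lt x y \<Longrightarrow> pos y - pos x = d x y"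
    using potential[OF assms(4) b] by metis
  have p: "p > 0" using assms by simp
  define L where "L t = {x\<in>K. (pos x + t) mod p < n}" for t
  have arc: "short p n (d x y)" if "x \<in> L t" "y \<in> L t" "lt x y" "\<not> p dvd d x y" for x y t
  proof -
    define \<alpha> \<beta> where "\<alpha> = (pos x + t) mod p" and "\<beta> = (pos y + t) mod p"
    have ab: "0 \<le> \<alpha>" "\<alpha> < n" "0 \<le> \<beta>" "\<beta> < n"
      using that p by (auto simp: \<alpha>_def \<beta>_def L_def)
    have "d x y = pos y - pos x" using pos[of x y] that by (simp add: L_def)
    also have "\<dots> mod p = (\<beta> - \<alpha>) mod p" by (simp add: \<alpha>_def \<beta>_def mod_diff_eq)
    finally have e: "d x y mod p = (\<beta> - \<alpha>) mod p" .
    have "\<beta> \<noteq> \<alpha>" using e that(4) by (auto simp: dvd_eq_mod_eq_0)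
    show ?thesis
    proof (cases "\<alpha> < \<beta>")
      case True
      then have "(\<beta> - \<alpha>) mod p = \<beta> - \<alpha>" using ab assms by (intro mod_pos_pos_trivial) auto
      then show ?thesis using e True ab by (simp add: short_def)
    next
      case False
      then have "(\<beta> - \<alpha> + p) mod p = \<beta> - \<alpha> + p"
        using ab assms \<open>\<beta> \<noteq> \<alpha>\<close> by (intro mod_pos_pos_trivial) auto
      then have "d x y mod p = \<beta> - \<alpha> + p" using e by simp
      then show ?thesis using False \<open>\<beta> \<noteq> \<alpha>\<close> ab by (simp add: short_def)
    qed
  qed
  have cl: "clique (adj (short p n)) (L t)" for t
    unfolding clique_def
  proof (intro ballI impI)
    fix x y assume xy: "x \<in> L t" "y \<in> L t" "x \<noteq> y"
    then have "adj (\<lambda>r. \<not> p dvd r) x y" using assms(4) by (auto simp: clique_def L_def)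
    then show "adj (short p n) x y" using arc xy by (auto simp: adj_def)
  qed
  have "(\<Sum>t\<in>{0..<p}. card (L t)) = (\<Sum>t\<in>{0..<p}. \<Sum>x\<in>K. if (pos x + t) mod p < n then 1 else 0)"
    unfolding L_def using assms(3) by (simp add: sum.If_cases Int_def)
  also have "\<dots> = (\<Sum>x\<in>K. \<Sum>t\<in>{0..<p}. if (pos x + t) mod p < n then 1 else 0)"
    by (rule sum.swap)
  also have "\<dots> = (\<Sum>x\<in>K. card {t\<in>{0..<p}. (pos x + t) mod p < n})"
    by (simp add: sum.If_cases Int_def)
  also have "\<dots> = (\<Sum>x\<in>K. nat n)"
    using assms p by (intro sum.cong refl card_shifts) auto
  also have "\<dots> = card K * nat n" by simp
  finally have total: "(\<Sum>t\<in>{0..<p}. card (L t)) = card K * nat n" .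
  have "\<exists>t\<in>{0..<p}. int (card K) * n \<le> int (card (L t)) * p"
  proof (rule ccontr)
    assume "\<not> ?thesis"
    then have "(\<Sum>t\<in>{0..<p}. int (card (L t)) * p) < (\<Sum>t\<in>{0..<p}. int (card K) * n)"
      using p by (intro sum_strict_mono) (auto simp: not_le)
    moreover have "(\<Sum>t\<in>{0..<p}. int (card (L t)) * p) = int (\<Sum>t\<in>{0..<p}. card (L t)) * p"
      by (simp add: sum_distrib_right)
    moreover have "(\<Sum>t\<in>{0..<p}. int (card K) * n) = int (card K) * n * p"
      using p by simp
    ultimately have "int (\<Sum>t\<in>{0..<p}. card (L t)) * p < int (card K) * n * p"
      by (simp only:)
    then show False unfolding total using assms(1) by simp
  qed
  then show ?thesis using that[of "L _"] cl by (auto simp: L_def)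
qed

theorem colorable_short:
  assumes "prime p" "2 * n \<le> p" "p < 3 * n" "finite S" "int m < n" "m > 0"
    and m: "\<And>K. K \<subseteq> S \<Longrightarrow> clique (adj (short p n)) K \<Longrightarrow> card K \<le> m"
  shows "colorable (adj (short p n)) S ((3 * m + 1) choose 3)"
proof -
  let ?full = "adj (\<lambda>r. \<not> p dvd r)"
  have p: "p > 0" using assms(1) prime_gt_0_int by blast
  have bound: "card K < 3 * m \<and> int (card K) < p" if K: "K \<subseteq> S" "clique ?full K" for K
  proof -
    have "0 < n" "n \<le> p" "finite K" using assms(2,4,5) finite_subset[OF K(1)] by auto
    then obtain L where L: "L \<subseteq> K" "clique (adj (short p n)) L" "int (card K) * n \<le> int (card L) * p"
      using large_short_clique K(2) by blast
    have "int (card L) \<le> int m" using m[of L] L K by auto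
    then have "int (card L) * p \<le> int m * p" using p by (intro mult_right_mono) auto
    then have *: "int (card K) * n \<le> int m * p" using L(3) by linarith
    also have "int m * p < int m * (3 * n)" using assms by (intro mult_strict_left_mono) auto
    finally have 1: "int (card K) * n < (3 * int m) * n" by simp
    note *
    also have "int m * p < n * p" using assms p by (intro mult_strict_right_mono) auto
    finally have 2: "int (card K) * n < p * n" by (simp add: mult.commute)
    show ?thesis using 1 2 \<open>0 < n\<close> by (simp add: mult_less_cancel_right)
  qed
  obtain w where w: "clique_no ?full S w" using ex_clique_no[OF assms(4)] .
  have max: "card K \<le> w" if "K \<subseteq> S" "clique ?full K" for K
    using w that by (simp add: clique_no_def)
  obtain K where K: "K \<subseteq> S" "clique ?full K" "card K = w"
    using w by (auto simp: clique_no_def)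
  have "int w < p" using bound[OF K(1,2)] K(3) by simp
  then have "colorable ?full S ((w + 2) choose 3)"
    using colorable_full[OF assms(1,4) max] by blast
  moreover have "w + 2 \<le> 3 * m + 1" using bound[OF K(1,2)] K(3) by simp
  then have "(w + 2) choose 3 \<le> (3 * m + 1) choose 3" by (rule binomial_le_binomial)
  ultimately show ?thesis
    using assms(2) p short_imp_not_dvd[of n p]
    by (elim colorable_mono) (auto simp: adj_def)
qed

end

section \<open>Digraphs of large chromatic number with unique paths\<close>

text \<open>
  The vertices of an oriented version of Zykov's graphs. \<open>Copy i v\<close> is the vertex \<open>v\<close> in the \<open>i\<close>-th
  copy of the previous graph, and \<open>Apex vs\<close> is a new vertex that receives an arc from the vertex
  \<open>vs ! i\<close> in the \<open>i\<close>-th copy, for each \<open>i\<close>.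
\<close>

datatype vertex = Copy nat vertex | Apex "vertex list"

text \<open>Reachability by a nonempty directed path.\<close>

fun below :: "vertex \<Rightarrow> vertex \<Rightarrow> bool" where
  "below (Copy i u) (Copy j v) \<longleftrightarrow> i = j \<and> below u v"
| "below (Copy i u) (Apex vs) \<longleftrightarrow> i < length vs \<and> (u = vs ! i \<or> below u (vs ! i))"
| "below (Apex us) v \<longleftrightarrow> False"

text \<open>
  The length of the path from the first vertex to the second; meaningful only for equal or
  reachable vertices.
\<close>

fun path_length :: "vertex \<Rightarrow> vertex \<Rightarrow> int" where
  "path_length (Copy i u) (Copy j v) = path_length u v"
| "path_length (Copy i u) (Apex vs) = 1 + path_length u (vs ! i)"
| "path_length (Apex us) v = 0"

lemma path_length_self: "path_length u u = 0"
  by (induction u) simp_all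

lemma below_trans:
  "below u v \<Longrightarrow> below v w \<Longrightarrow> below u w \<and> path_length u w = path_length u v + path_length v w"
proof (induction u arbitrary: v w)
  case (Copy i u)
  then obtain v' where v: "v = Copy i v'" "below u v'" by (cases v) auto
  show ?case
  proof (cases w)
    case (Copy j w')
    then show ?thesis using Copy.IH[of v' w'] Copy.prems v by simp
  next
    case (Apex ws)
    then have "i < length ws" and "v' = ws ! i \<or> below v' (ws ! i)" using Copy.prems v by simp_all
    then show ?thesis
      using Copy.IH[of v' "ws ! i"] v Apex path_length_self[of v'] by auto
  qed
qed simp

interpretation zykov: distance_order below path_length
proof
  show "below u w" if "below u v" "below v w" for u v w
    using below_trans[OF that] by (rule conjunct1)
  show "path_length u w = path_length u v + path_length v w" if "below u v" "below v w" for u v w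
    using below_trans[OF that] by (rule conjunct2)
qed (rule path_length_self)

text \<open>
  \<open>zykov 0\<close> is a single vertex, and \<open>zykov (Suc k)\<close> consists of \<open>k + 1\<close> copies of \<open>zykov k\<close> and one apex for every way of choosing a
  vertex from each copy.
\<close>

fun zykov :: "nat \<Rightarrow> vertex set" where
  "zykov 0 = {Apex []}"
| "zykov (Suc k) = (\<Union>i<Suc k. Copy i ` zykov k) \<union> Apex ` {vs. set vs \<subseteq> zykov k \<and> length vs = Suc k}"

lemma finite_zykov: "finite (zykov k)"
  by (induction k) (auto simp: finite_lists_length_eq)

text \<open>
  In a colouring with \<open>k + 1\<close> colours every colour \<open>i\<close> occurs in the \<open>i\<close>-th copy, and the apex over
  vertices chosen accordingly sees all colours.
\<close>

lemma zykov_not_colorable: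
  "\<not> colorable (\<lambda>u v. below u v \<and> path_length u v = 1) (zykov k) k"
proof (induction k)
  case 0
  then show ?case by (simp add: colorable_def)
next
  case (Suc k)
  let ?E = "\<lambda>u v. below u v \<and> path_length u v = 1"
  show ?case
  proof
    assume "colorable ?E (zykov (Suc k)) (Suc k)"
    then obtain c where c: "\<And>v. v \<in> zykov (Suc k) \<Longrightarrow> c v < Suc k"
      "\<And>u v. u \<in> zykov (Suc k) \<Longrightarrow> v \<in> zykov (Suc k) \<Longrightarrow> ?E u v \<Longrightarrow> c u \<noteq> c v"
      unfolding colorable_def by blast
    have "\<exists>v\<in>zykov k. c (Copy i v) = i" if i: "i < Suc k" for i
    proof (rule ccontr)
      assume none: "\<not> ?thesis"
      have copy: "Copy i v \<in> zykov (Suc k)" if "v \<in> zykov k" for v using i that by auto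
      have "colorable ?E (zykov k) (card ({..<Suc k} - {i}))"
      proof (rule colorable_by_finite_set)
        show "c (Copy i v) \<in> {..<Suc k} - {i}" if "v \<in> zykov k" for v
          using c(1)[OF copy[OF that]] none that by blast
        show "c (Copy i u) \<noteq> c (Copy i v)" if "u \<in> zykov k" "v \<in> zykov k" "?E u v" for u v
          using c(2)[OF copy copy] that by simp
      qed simp
      moreover have "card ({..<Suc k} - {i}) = k" using i by simp
      ultimately show False using Suc.IH by simp
    qed
    then have "\<forall>i\<in>{..<Suc k}. \<exists>v. v \<in> zykov k \<and> c (Copy i v) = i" by blast
    then obtain g where g: "\<forall>i\<in>{..<Suc k}. g i \<in> zykov k \<and> c (Copy i (g i)) = i"
      using bchoice[of "{..<Suc k}" "\<lambda>i v. v \<in> zykov k \<and> c (Copy i v) = i"] by blast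
    define vs where "vs = map g [0..<Suc k]"
    have vs: "length vs = Suc k" "\<And>i. i < Suc k \<Longrightarrow> vs ! i = g i"
      by (simp_all add: vs_def del: upt_Suc)
    have "set vs = g ` {..<Suc k}" by (simp add: vs_def lessThan_atLeast0 del: upt_Suc)
    have "set vs \<subseteq> zykov k" unfolding \<open>set vs = _\<close> using g by blast
    then have apex: "Apex vs \<in> zykov (Suc k)" using vs(1) by simp
    define i where "i = c (Apex vs)"
    have i: "i < Suc k" using c(1)[OF apex] by (simp add: i_def)
    have gi: "g i \<in> zykov k" "c (Copy i (g i)) = i" using g i by blast+
    have "Copy i (g i) \<in> zykov (Suc k)" using gi(1) i by auto
    moreover have "?E (Copy i (g i)) (Apex vs)" using i vs by (simp add: path_length_self)
    ultimately have "c (Copy i (g i)) \<noteq> c (Apex vs)" using c(2) apex by blast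
    then show False using gi(2) by (simp add: i_def)
  qed
qed

text \<open>
  The vertex set is a subset of \<open>zykov k\<close> with chromatic number exactly \<open>k\<close>. Its clique number
  is then \<open>n\<close>, because a smaller clique number would allow fewer than \<open>k\<close> colours.
\<close>

lemma exists_graph:
  fixes n k :: nat
  assumes n: "n \<ge> 2" and k: "(3 * n + 1) choose 3 \<le> k"
  obtains E :: "vertex \<Rightarrow> vertex \<Rightarrow> bool" and S where
    "finite S" "\<forall>u v. E u v \<longrightarrow> E v u" "\<forall>u. \<not> E u u"
    "colorable E S k" "\<not> colorable E S (k - 1)" "clique_no E S n"
    "\<forall>T m. T \<subseteq> S \<longrightarrow> clique_no E T m \<longrightarrow> 0 < m \<longrightarrow> m < n \<longrightarrow>
      colorable E T ((3 * m + 1) choose 3)"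
proof -
  obtain q where q: "prime q" "2 * n < q" "q < 3 * n" using prime_between_2n_3n[OF n] by blast
  define p where "p = int q"
  define E where "E = zykov.adj (zykov.short p (int n))"
  have p: "prime p" "2 * int n \<le> p" "p < 3 * int n" using q by (auto simp: p_def)
  have sym: "E v u" if "E u v" for u v using that zykov.adj_sym by (simp add: E_def)
  have irrefl: "\<not> E u u" for u
    using p n by (auto simp: E_def zykov.adj_def zykov.short_def path_length_self)
  have sub: "colorable E T ((3 * m + 1) choose 3)"
    if "finite T" "clique_no E T m" "0 < m" "m < n" for T m
    using that unfolding E_def
    by (intro zykov.colorable_short[OF p]) (auto simp: clique_no_def)
  have k0: "k > 0" using k n zero_less_binomial[of 3 "3 * n + 1"] by linarith
  have one: "zykov.short p (int n) 1" using p n by (simp add: zykov.short_def)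
  have "\<not> colorable E (zykov k) (k - 1)"
  proof
    assume "colorable E (zykov k) (k - 1)"
    then have "colorable (\<lambda>u v. below u v \<and> path_length u v = 1) (zykov k) k"
      by (rule colorable_mono) (use one in \<open>auto simp: E_def zykov.adj_def\<close>)
    then show False using zykov_not_colorable by blast
  qed
  then obtain S where S: "S \<subseteq> zykov k" "\<not> colorable E S (k - 1)" "colorable E S (Suc (k - 1))"
    using critical_subset[of "zykov k" E "k - 1"] finite_zykov irrefl by blast
  then have S: "S \<subseteq> zykov k" "\<not> colorable E S (k - 1)" "colorable E S k"
    using k0 by simp_all
  have finS: "finite S" using S(1) finite_zykov by (rule finite_subset)
  obtain m where m: "clique_no E S m" using ex_clique_no[OF finS] .
  have "m \<le> n"
  proof -
    obtain K where "clique E K" "card K = m" using m by (auto simp: clique_no_def)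
    then show ?thesis
      using zykov.card_short_clique[of "int n" p K] p n by (simp add: E_def)
  qed
  moreover have "\<not> m < n"
  proof
    assume "m < n"
    have "S \<noteq> {}" using S(2) by (auto simp: colorable_def)
    then obtain v where "v \<in> S" by blast
    then have "{v} \<subseteq> S" "clique E {v}" by (auto simp: clique_def)
    then have "card {v} \<le> m" using m unfolding clique_no_def by blast
    then have "m > 0" by simp
    then have "colorable E S ((3 * m + 1) choose 3)" using sub[OF finS m] \<open>m < n\<close> by blast
    moreover have "(3 * m + 1) choose 3 \<le> k - 1"
    proof -
      have "Suc ((3 * m + 1) choose 3) \<le> ((3 * m + 1) choose 2) + ((3 * m + 1) choose 3)"
      proof -
        have "2 \<le> 3 * m + 1" using \<open>m > 0\<close> by simp
        from zero_less_binomial[OF this] show ?thesis by linarith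
      qed
      also have "\<dots> = Suc (3 * m + 1) choose 3" by (simp add: numeral_3_eq_3 numeral_2_eq_2)
      also have "\<dots> \<le> (3 * n + 1) choose 3"
        using \<open>m < n\<close> by (intro binomial_le_binomial) simp
      finally show ?thesis using k by simp
    qed
    ultimately show False using S(2) colorable_mono[of E S _ "k - 1" S E] by blast
  qed
  ultimately have "m = n" by simp
  with m have "clique_no E S n" by simp
  moreover have "colorable E T ((3 * m + 1) choose 3)"
    if "T \<subseteq> S" "clique_no E T m" "0 < m" "m < n" for T m
    using sub[OF finite_subset[OF that(1) finS] that(2-4)] .
  ultimately show thesis using that[of S E] finS sym irrefl S(2,3) by blast
qed

section \<open>Graphs as digraphs\<close>

text \<open>The adjacency relation of a graph.\<close>

definition adjacent :: "'a pair_pre_digraph \<Rightarrow> 'a \<Rightarrow> 'a \<Rightarrow> bool" where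
  "adjacent G u v \<longleftrightarrow> (u, v) \<in> parcs G"

lemma proper_coloring_iff:
  assumes "pair_graph G"
  shows "(\<exists>c. proper_coloring G k c) \<longleftrightarrow> colorable (adjacent G) (pverts G) k"
proof -
  interpret pair_graph G by fact
  have "proper_coloring G k c \<longleftrightarrow> (\<forall>v\<in>pverts G. c v < k) \<and>
      (\<forall>u\<in>pverts G. \<forall>v\<in>pverts G. adjacent G u v \<longrightarrow> c u \<noteq> c v)" for c
    unfolding proper_coloring_def adjacent_def using in_arcsD1 in_arcsD2 by blast
  then show ?thesis by (simp add: colorable_def)
qed

lemma colorable_card:
  assumes "finite S" "\<And>u. \<not> E u u"
  shows "colorable E S (card S)"
proof (rule colorable_by_finite_set)
  show "u \<noteq> v" if "E u v" for u v using that assms(2)[of u] by blast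
qed (use assms(1) in simp_all)

lemma chromatic_number_le_iff:
  assumes "pair_graph G"
  shows "chromatic_number G \<le> k \<longleftrightarrow> colorable (adjacent G) (pverts G) k"
proof -
  interpret pair_graph G by fact
  have chi: "chromatic_number G = (LEAST k. colorable (adjacent G) (pverts G) k)"
    unfolding chromatic_number_def proper_coloring_iff[OF assms] ..
  have irrefl: "\<not> adjacent G u u" for u
    using no_loops' by (auto simp: adjacent_def)
  have "colorable (adjacent G) (pverts G) (card (pverts G))"
    using colorable_card[OF pair_finite_verts irrefl] .
  then have "colorable (adjacent G) (pverts G) (chromatic_number G)"
    unfolding chi by (rule LeastI)
  then show ?thesis
    using colorable_mono[of "adjacent G" "pverts G" _ k "pverts G" "adjacent G"]
      Least_le[of "\<lambda>k. colorable (adjacent G) (pverts G) k" k] chi by auto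
qed

lemma clique_number_eq_iff:
  assumes "pair_graph G"
  shows "clique_number G = m \<longleftrightarrow> clique_no (adjacent G) (pverts G) m"
proof -
  interpret pair_graph G by fact
  define W where "W = card ` {K. is_clique G K}"
  have W: "W = {card K | K. K \<subseteq> pverts G \<and> clique (adjacent G) K}"
    by (auto simp: W_def is_clique_def clique_def adjacent_def)
  have "W \<subseteq> {..card (pverts G)}" using card_mono[OF pair_finite_verts] by (auto simp: W)
  then have finW: "finite W" by (rule finite_subset) simp
  have "{} \<subseteq> pverts G \<and> clique (adjacent G) {}" by (simp add: clique_def)
  then have "W \<noteq> {}" unfolding W by blast
  then have "Max W = m \<longleftrightarrow> m \<in> W \<and> (\<forall>x\<in>W. x \<le> m)" using Max_eq_iff[OF finW] by blast
  also have "\<dots> \<longleftrightarrow> clique_no (adjacent G) (pverts G) m"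
    unfolding clique_no_def W by blast
  finally show ?thesis by (simp add: clique_number_def W_def)
qed

section \<open>The class of graphs\<close>

text \<open>
  Every induced subgraph with clique number \<open>m \<ge> 1\<close> has chromatic number at most \<open>f m\<close>; there is
  no condition for those \<open>m\<close> with \<open>f m = \<infinity>\<close>.
\<close>

definition bounded_by :: "(nat \<Rightarrow> enat) \<Rightarrow> ('a \<Rightarrow> 'a \<Rightarrow> bool) \<Rightarrow> 'a set \<Rightarrow> bool" where
  "bounded_by f E S \<longleftrightarrow> (\<forall>T\<subseteq>S. \<forall>m k. 1 \<le> m \<longrightarrow> clique_no E T m \<longrightarrow> f m = enat k \<longrightarrow> colorable E T k)"

lemma bounded_byD:
  "bounded_by f E S \<Longrightarrow> T \<subseteq> S \<Longrightarrow> 1 \<le> m \<Longrightarrow> clique_no E T m \<Longrightarrow> f m = enat k \<Longrightarrow>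
    colorable E T k"
  by (simp add: bounded_by_def)

lemma bounded_by_image:
  assumes "bounded_by f E S" "inj_on h S" "\<And>u v. u \<in> S \<Longrightarrow> v \<in> S \<Longrightarrow> F (h u) (h v) \<longleftrightarrow> E u v"
  shows "bounded_by f F (h ` S)"
  unfolding bounded_by_def all_subset_image
proof (intro allI impI)
  fix T m k assume T: "T \<subseteq> S" and m: "1 \<le> m" "clique_no F (h ` T) m" "f m = enat k"
  have inj: "inj_on h T" using assms(2) T by (rule inj_on_subset)
  have eq: "F (h u) (h v) \<longleftrightarrow> E u v" if "u \<in> T" "v \<in> T" for u v using assms(3) that T by blast
  have "clique_no E T m" using m(2) clique_no_image[of h T F E, OF inj eq] by simp
  then have "colorable E T k" using bounded_byD[OF assms(1) T m(1) _ m(3)] by simp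
  then show "colorable F (h ` T) k" using colorable_image[of h T F E, OF inj eq] by simp
qed

text \<open>The largest hereditary class whose bounding function is at most \<open>f\<close> on positive numbers.\<close>

definition bounded_graphs :: "(nat \<Rightarrow> enat) \<Rightarrow> nat pair_pre_digraph set" where
  "bounded_graphs f = {G. pair_graph G \<and> bounded_by f (adjacent G) (pverts G)}"

lemma pair_graphI:
  assumes "finite (pverts G)" "parcs G \<subseteq> pverts G \<times> pverts G"
    and "\<And>u v. (u, v) \<in> parcs G \<Longrightarrow> (v, u) \<in> parcs G" "\<And>u. (u, u) \<notin> parcs G"
  shows "pair_graph G"
proof unfold_locales
  show "symmetric (with_proj G)" using assms(3) by (simp add: symmetric_def sym_def)
  show "finite (parcs G)" using assms(2) by (rule finite_subset) (simp add: assms(1))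
  show "fst e \<noteq> snd e" if "e \<in> parcs G" for e
    using that assms(4)[of "fst e"] by (metis prod.collapse)
qed (use assms(1,2) in auto)

lemma pair_graph_of_image:
  assumes "pair_graph G" "inj_on h (pverts G)" "pverts H = h ` pverts G"
    "parcs H = (\<lambda>(u, v). (h u, h v)) ` parcs G"
  shows "pair_graph H"
proof -
  interpret pair_graph G by fact
  have arcE: "\<exists>u v. a = h u \<and> b = h v \<and> (u, v) \<in> parcs G" if "(a, b) \<in> parcs H" for a b
    using that unfolding assms(4) by force
  show ?thesis
  proof (rule pair_graphI)
    show "finite (pverts H)" using pair_finite_verts assms(3) by simp
    show "parcs H \<subseteq> pverts H \<times> pverts H"
      using in_arcsD1 in_arcsD2 unfolding assms(3,4) by auto
    show "(b, a) \<in> parcs H" if ab: "(a, b) \<in> parcs H" for a b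
    proof -
      obtain u v where uv: "a = h u" "b = h v" "(u, v) \<in> parcs G" using arcE[OF ab] by blast
      show ?thesis unfolding assms(4) uv(1,2)
        by (rule image_eqI[of _ _ "(v, u)"]) (simp_all add: arcs_symmetric[OF uv(3)])
    qed
    show "(a, a) \<notin> parcs H" for a
    proof
      assume "(a, a) \<in> parcs H"
      then obtain u v where uv: "a = h u" "a = h v" "(u, v) \<in> parcs G" using arcE by blast
      have "u = v" by (rule inj_onD[OF assms(2)]) (use uv in_arcsD1 in_arcsD2 in auto)
      then show False using no_loops'[OF uv(3)] by blast
    qed
  qed
qed

lemma graph_class_bounded_graphs: "graph_class (bounded_graphs f)"
  unfolding graph_class_def
proof (intro conjI ballI allI impI)
  fix G assume "G \<in> bounded_graphs f"
  then show "pair_graph G" by (simp add: bounded_graphs_def)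
next
  fix G H :: "nat pair_pre_digraph"
  assume G: "G \<in> bounded_graphs f" and iso: "digraph_iso (with_proj G) (with_proj H)"
  interpret pair_graph G using G by (simp add: bounded_graphs_def)
  obtain i where i: "pre_digraph.digraph_isomorphism (with_proj G) i"
    "with_proj H = app_iso i (with_proj G)"
    using iso unfolding digraph_iso_def by blast
  define h where "h = iso_verts i"
  have inj: "inj_on h (pverts G)"
    using i(1) by (simp add: pre_digraph.digraph_isomorphism_def h_def)
  have verts: "pverts H = h ` pverts G"
    using arg_cong[OF i(2), of verts] by (simp add: h_def)
  have tail: "iso_tail i = fst" and head: "iso_head i = snd"
    using arg_cong[OF i(2), of tail] arg_cong[OF i(2), of head] by simp_all
  have "iso_arcs i e = (h (fst e), h (snd e))" if "e \<in> parcs G" for e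
    using i(1) that tail head
    by (simp add: pre_digraph.digraph_isomorphism_def h_def prod_eq_iff)
  moreover have "parcs H = iso_arcs i ` parcs G"
    using arg_cong[OF i(2), of arcs] by simp
  ultimately have arcs: "parcs H = (\<lambda>(u, v). (h u, h v)) ` parcs G"
    by (simp add: case_prod_unfold)
  have "adjacent H (h u) (h v) \<longleftrightarrow> adjacent G u v" if uv: "u \<in> pverts G" "v \<in> pverts G" for u v
  proof
    assume "adjacent H (h u) (h v)"
    then obtain u' v' where uv': "(u', v') \<in> parcs G" "h u = h u'" "h v = h v'"
      by (auto simp: adjacent_def arcs)
    then have "u = u'" "v = v'" using inj_onD[OF inj] uv in_arcsD1 in_arcsD2 by blast+
    then show "adjacent G u v" using uv' by (simp add: adjacent_def)
  next
    assume "adjacent G u v"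
    then show "adjacent H (h u) (h v)" by (force simp: adjacent_def arcs)
  qed
  then have "bounded_by f (adjacent H) (h ` pverts G)"
    using G inj by (intro bounded_by_image[of f "adjacent G"]) (simp_all add: bounded_graphs_def)
  then show "H \<in> bounded_graphs f"
    using pair_graph_of_image[OF _ inj verts arcs] verts pair_graph by (simp add: bounded_graphs_def)
qed

lemma hereditary_bounded_graphs: "hereditary (bounded_graphs f)"
  unfolding hereditary_def
proof (intro ballI allI impI)
  fix G H assume G: "G \<in> bounded_graphs f" and H: "induced_subgraph (with_proj H) (with_proj G)"
  interpret pair_graph G using G by (simp add: bounded_graphs_def)
  have sub: "pverts H \<subseteq> pverts G"
    and arcs: "parcs H = {e \<in> parcs G. fst e \<in> pverts H \<and> snd e \<in> pverts H}"
    using H by (auto simp: induced_subgraph_def subgraph_def)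
  have "pair_graph H"
  proof (rule pair_graphI)
    show "finite (pverts H)" using finite_subset[OF sub pair_finite_verts] .
    show "(u, v) \<in> parcs H \<Longrightarrow> (v, u) \<in> parcs H" for u v
      using arcs_symmetric by (simp add: arcs)
    show "(u, u) \<notin> parcs H" for u using no_loops' by (auto simp: arcs)
  qed (auto simp: arcs)
  moreover have "bounded_by f (adjacent H) ((\<lambda>v. v) ` pverts H)"
  proof (rule bounded_by_image)
    show "bounded_by f (adjacent G) (pverts H)"
      using G sub unfolding bounded_graphs_def bounded_by_def by blast
  qed (simp_all add: adjacent_def arcs)
  ultimately show "H \<in> bounded_graphs f" by (simp add: bounded_graphs_def)
qed

text \<open>Copying an abstract finite graph to vertices in \<^typ>\<open>nat\<close>.\<close>

lemma nat_graph:
  assumes "finite S" "\<And>u v. E u v \<Longrightarrow> E v u" "\<And>u. \<not> E u u" "bounded_by f E S"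
    "colorable E S k" "\<not> colorable E S (k - 1)" "clique_no E S n"
  shows "\<exists>G\<in>bounded_graphs f. clique_number G = n \<and> chromatic_number G = k"
proof -
  obtain h :: "'a \<Rightarrow> nat" where inj: "inj_on h S"
    using finite_imp_inj_to_nat_seg[OF assms(1)] by blast
  define G where "G = \<lparr>pverts = h ` S, parcs = {(h u, h v) | u v. u \<in> S \<and> v \<in> S \<and> E u v}\<rparr>"
  have adj: "adjacent G (h u) (h v) \<longleftrightarrow> E u v" if "u \<in> S" "v \<in> S" for u v
  proof
    assume "adjacent G (h u) (h v)"
    then obtain u' v' where uv': "h u = h u'" "h v = h v'" "u' \<in> S" "v' \<in> S" "E u' v'"
      by (auto simp: adjacent_def G_def)
    have "u = u'" "v = v'"
      using inj_onD[OF inj uv'(1) that(1) uv'(3)] inj_onD[OF inj uv'(2) that(2) uv'(4)] by simp_all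
    then show "E u v" using uv'(5) by simp
  next
    assume "E u v"
    then show "adjacent G (h u) (h v)" using that by (auto simp: adjacent_def G_def)
  qed
  have arcE: "\<exists>u v. a = h u \<and> b = h v \<and> u \<in> S \<and> v \<in> S \<and> E u v"
    if "(a, b) \<in> parcs G" for a b using that by (simp add: G_def)
  have G: "pair_graph G"
  proof (rule pair_graphI)
    show "finite (pverts G)" using assms(1) by (simp add: G_def)
    show "parcs G \<subseteq> pverts G \<times> pverts G" by (auto simp: G_def)
    show "(b, a) \<in> parcs G" if ab: "(a, b) \<in> parcs G" for a b
    proof -
      obtain u v where uv: "a = h u" "b = h v" "u \<in> S" "v \<in> S" "E u v" using arcE[OF ab] by blast
      then show ?thesis using assms(2)[OF uv(5)] by (auto simp: G_def)
    qed
    show "(a, a) \<notin> parcs G" for a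
    proof
      assume "(a, a) \<in> parcs G"
      then obtain u v where uv: "h u = h v" "u \<in> S" "v \<in> S" "E u v" using arcE by metis
      have "u = v" using inj_onD[OF inj uv(1-3)] .
      then show False using assms(3) uv(4) by blast
    qed
  qed
  have verts: "pverts G = h ` S" by (simp add: G_def)
  have "G \<in> bounded_graphs f"
    using G bounded_by_image[of f E S h "adjacent G", OF assms(4) inj adj] by (simp add: bounded_graphs_def verts)
  moreover have "clique_number G = n"
    unfolding clique_number_eq_iff[OF G] verts
    using clique_no_image[of h S "adjacent G" E, OF inj adj] assms(7) by simp
  moreover have "chromatic_number G \<le> l \<longleftrightarrow> colorable E S l" for l
    unfolding chromatic_number_le_iff[OF G] verts
    using colorable_image[of h S "adjacent G" E, OF inj adj] by simp
  then have "chromatic_number G \<le> k" "\<not> chromatic_number G \<le> k - 1"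
    using assms(5,6) by simp_all
  then have "chromatic_number G = k" by linarith
  ultimately show ?thesis by blast
qed

lemma graph_attaining:
  assumes f1: "f 1 = (1 :: enat)"
    and f: "\<And>n. n \<ge> 2 \<Longrightarrow> f n \<ge> enat ((3 * n + 1) choose 3)"
    and n: "n \<ge> 1" and k: "enat k \<le> f n" "n = 1 \<Longrightarrow> k = 1" "n \<ge> 2 \<Longrightarrow> (3 * n + 1) choose 3 \<le> k"
  shows "\<exists>G\<in>bounded_graphs f. clique_number G = n \<and> chromatic_number G = k"
proof (cases "n = 1")
  case True
  show ?thesis
  proof -
    \<comment> \<open>The graph with a single vertex.\<close>
    let ?E = "\<lambda>(u :: nat) (v :: nat). False"
    have cl: "clique_no ?E {0} n"
    proof -
      have "card K \<le> 1" if "K \<subseteq> {0}" for K :: "nat set"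
        using card_mono[of "{0}" K] that by simp
      moreover have "clique ?E {0}" by (simp add: clique_def)
      moreover have "\<exists>K\<subseteq>{0}. clique ?E K \<and> card K = 1"
        using \<open>clique ?E {0}\<close> by (intro exI[of _ "{0}"]) simp
      ultimately show ?thesis unfolding clique_no_def True by blast
    qed
    have l: "0 < l" if "f m = enat l" "m \<ge> 1" for m l
    proof (cases "m = 1")
      case False
      then have "enat ((3 * m + 1) choose 3) \<le> enat l" using f[of m] that by simp
      moreover have "0 < (3 * m + 1) choose 3" using that by (intro zero_less_binomial) simp
      ultimately show ?thesis unfolding enat_ord_simps by linarith
    qed (use f1 that in \<open>simp add: one_enat_def\<close>)
    have bd: "bounded_by f ?E {0}"
      unfolding bounded_by_def
    proof (intro allI impI)
      fix T m l assume "1 \<le> m" "f m = enat l"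
      then have "0 < l" using l by blast
      then show "colorable ?E T l" unfolding colorable_def by (intro exI[of _ "\<lambda>_. 0"]) simp
    qed
    have "colorable ?E {0} k" "\<not> colorable ?E {0} (k - 1)"
      using k(2) True by (auto simp: colorable_def)
    then show ?thesis using nat_graph[of "{0}" ?E f k n] bd cl by blast
  qed
next
  case False
  then have n2: "n \<ge> 2" using n by simp
  obtain E :: "vertex \<Rightarrow> vertex \<Rightarrow> bool" and S where
    E': "finite S" "\<forall>u v. E u v \<longrightarrow> E v u" "\<forall>u. \<not> E u u"
    and S: "colorable E S k" "\<not> colorable E S (k - 1)" "clique_no E S n"
    and sub: "\<forall>T m. T \<subseteq> S \<longrightarrow> clique_no E T m \<longrightarrow> 0 < m \<longrightarrow> m < n \<longrightarrow>
      colorable E T ((3 * m + 1) choose 3)"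
    by (rule exists_graph[OF n2 k(3)[OF n2]])
  have E: "finite S" "\<And>u v. E u v \<Longrightarrow> E v u" "\<And>u. \<not> E u u" using E' by blast+
  have "bounded_by f E S"
    unfolding bounded_by_def
  proof (intro allI impI)
    fix T m l assume T: "T \<subseteq> S" "1 \<le> m" "clique_no E T m" "f m = enat l"
    have "m \<le> n"
    proof -
      obtain K where "K \<subseteq> T" "clique E K" "card K = m" using T(3) unfolding clique_no_def by blast
      moreover have "\<forall>K\<subseteq>S. clique E K \<longrightarrow> card K \<le> n" using S(3) by (simp add: clique_no_def)
      ultimately show ?thesis using T(1) by blast
    qed
    then consider "m = n" | "m = 1" | "2 \<le> m" "m < n" using T(2) by linarith
    then show "colorable E T l"
    proof cases
      case 1
      then have "k \<le> l" using k(1) T(4) by simp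
      then show ?thesis using S(1) T(1) colorable_mono[of E S k l T E] by blast
    next
      case 2
      then have "clique_no E T 1" "l = 1" using T(3,4) f1 by (simp_all add: one_enat_def)
      then show ?thesis using colorable_one[of E T, OF _ E(2,3)] by simp
    next
      case 3
      have "enat ((3 * m + 1) choose 3) \<le> enat l" using f[OF 3(1)] T(4) by simp
      then have "(3 * m + 1) choose 3 \<le> l" by simp
      moreover have "colorable E T ((3 * m + 1) choose 3)" using sub T 3 by simp
      ultimately show ?thesis using colorable_mono[of E T _ l T E] by blast
    qed
  qed
  from nat_graph[OF E this S] show ?thesis .
qed

theorem theorem1:
  fixes f :: "nat \<Rightarrow> enat"
  assumes "f 1 = 1"
    and "\<And>n. n \<ge> 2 \<Longrightarrow> f n \<ge> enat ((3 * n + 1) choose 3)"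
  shows "\<exists>C. graph_class C \<and> hereditary C \<and> (\<forall>n\<ge>1. chi_bounding C n = f n)"
proof (intro exI conjI allI impI)
  show "graph_class (bounded_graphs f)" by (rule graph_class_bounded_graphs)
  show "hereditary (bounded_graphs f)" by (rule hereditary_bounded_graphs)
  fix n :: nat assume n: "1 \<le> n"
  let ?A = "{G \<in> bounded_graphs f. clique_number G = n}"
  show "chi_bounding (bounded_graphs f) n = f n"
  proof (rule antisym)
    show "chi_bounding (bounded_graphs f) n \<le> f n"
      unfolding chi_bounding_def
    proof (rule SUP_least)
      fix G assume "G \<in> ?A"
      then have G: "pair_graph G" "bounded_by f (adjacent G) (pverts G)" "clique_number G = n"
        by (simp_all add: bounded_graphs_def)
      show "enat (chromatic_number G) \<le> f n"
      proof (cases "f n")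
        case (enat k)
        then have "colorable (adjacent G) (pverts G) k"
          using bounded_byD[OF G(2) subset_refl n] G(3) clique_number_eq_iff[OF G(1)] by simp
        then show ?thesis using chromatic_number_le_iff[OF G(1)] enat by simp
      qed simp
    qed
    have ge: "enat k \<le> chi_bounding (bounded_graphs f) n"
      if k: "enat k \<le> f n" "n = 1 \<Longrightarrow> k = 1" "n \<ge> 2 \<Longrightarrow> (3 * n + 1) choose 3 \<le> k" for k
    proof -
      obtain G where "G \<in> ?A" "chromatic_number G = k"
        using graph_attaining[OF assms n k] by blast
      then show ?thesis unfolding chi_bounding_def by (auto intro: SUP_upper2)
    qed
    show "f n \<le> chi_bounding (bounded_graphs f) n"
    proof (cases "f n")
      case (enat k)
      have "n = 1 \<Longrightarrow> k = 1" using enat assms(1) by (simp add: one_enat_def)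
      moreover have "n \<ge> 2 \<Longrightarrow> (3 * n + 1) choose 3 \<le> k" using assms(2)[of n] enat by simp
      ultimately show ?thesis using ge[of k] enat by simp
    next
      case infinity
      then have "n \<noteq> 1" using assms(1) by (auto simp: one_enat_def)
      have large: "enat k \<le> chi_bounding (bounded_graphs f) n" for k
      proof -
        have "enat k \<le> enat (max k ((3 * n + 1) choose 3))" by simp
        also have "\<dots> \<le> chi_bounding (bounded_graphs f) n"
          using \<open>n \<noteq> 1\<close> infinity by (intro ge) simp_all
        finally show ?thesis .
      qed
      have "chi_bounding (bounded_graphs f) n = \<infinity>"
      proof (cases "chi_bounding (bounded_graphs f) n")
        case (enat b)
        then show ?thesis using large[of "Suc b"] by simp
      qed
      then show ?thesis by simp
    qed
  qed
qed

end
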